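(* Let $\ell$ be a positive integer. Suppose the differential operators $$P=\frac{\partial^2}{\partial x^2}+\frac{\partial^2}{\partial y^2}+R(x,y),\qquad Q=\sum_{i=0}^mc_i\frac{\partial^m}{\partial x^{m-i}\partial y^i}+\sum_{i+j\le m-2}S_{i,j}(x,y)\frac{\partial^{i+j}}{\partial x^i\partial y^j}$$ satisfy $[P,Q]=0$ and $\sigma_m(Q)\notin\mathbb C[\sigma(P)]$. Here $R(x,y)$ and $S_{i,j}(x,y)$ are square matrices of size $\ell$ whose components are functions of $(x,y)$, and $c_i\in\mathbb C$. Put $$\Bigl(\xi\frac{\partial}{\partial\tau}-\tau\frac{\partial}{\partial\xi}\Bigr)\sum_{i=0}^mc_i\xi^{m-i}\tau^i=\prod_{\nu=1}^L(a_\nu\xi-b_\nu\tau)^{m_\nu}$$ with suitable $(a_\nu,b_\nu)\in\mathbb C^2\setminus\{0\}$ satisfying $a_\nu b_\mu\ne a_\mu b_\nu$ for $\mu\neq\nu$, where the $m_\nu$ are positive integers and $m_1+\cdots+m_L=m$. Then $$R(x,y)=\sum_{\nu=1}^L\sum_{i=0}^{m_\nu-1}(b_\nu x+a_\nu y)^iR_{\nu,i}(a_\nu x-b_\nu y)$$ with $m$ square matrices $R_{\nu,i}(t)$ of size $\ell$ whose components are functions of the one variable $t$.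
   Context: $m$ is a positive integer and the indices $i,j$ are non-negative integers. $\sigma(P)=\xi^2+\tau^2$ and $\sigma_m(Q)=\sum_{i=0}^mc_i\xi^{m-i}\tau^i$ are the principal symbols, with $\xi$ and $\tau$ corresponding to $\partial/\partial x$ and $\partial/\partial y$ (they are scalar, i.e. multiples of the identity matrix of size $\ell$); $\mathbb C[\sigma(P)]$ is the ring of polynomials in $\sigma(P)$ with complex coefficients. $[P,Q]=PQ-QP$.
   Formalization: For factors with a_ν²+b_ν²=0 the form b_νx+a_νy is replaced by a_νx+b_νy, as the printed formula fails there if m_ν≥2 (P=∂x²+∂y²+x−iy, Q=(∂x+i∂y)²+2(x+iy)); "functions" are read as holomorphic, on an open convex domain in C². *)

theory Defs
  imports "HOL-Complex_Analysis.Complex_Analysis" "HOL-Computational_Algebra.Polynomial"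
begin

text \<open>
  The variables \<open>x, y\<close> are complex and "functions of \<open>(x, y)\<close>" are holomorphic functions on an open
  subset of \<open>\<complex> \<times> \<complex>\<close>.  Matrices of size \<open>\<ell>\<close> have type \<open>complex ^ 'l ^ 'l\<close> with \<open>\<ell> = CARD('l)\<close>.
\<close>

definition holo2 :: "(complex \<times> complex) set \<Rightarrow> (complex \<times> complex \<Rightarrow> complex) \<Rightarrow> bool" where
  "holo2 U f \<longleftrightarrow> (\<forall>p\<in>U. \<exists>\<alpha> \<beta>. (f has_derivative (\<lambda>(h, k). \<alpha> * h + \<beta> * k)) (at p))"

definition holo2_vec :: "(complex \<times> complex) set \<Rightarrow> (complex \<times> complex \<Rightarrow> complex ^ 'l) \<Rightarrow> bool" where
  "holo2_vec U u \<longleftrightarrow> (\<forall>r. holo2 U (\<lambda>p. u p $ r))"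

definition holo2_mat :: "(complex \<times> complex) set \<Rightarrow> (complex \<times> complex \<Rightarrow> complex ^ 'l ^ 'l) \<Rightarrow> bool" where
  "holo2_mat U A \<longleftrightarrow> (\<forall>r s. holo2 U (\<lambda>p. A p $ r $ s))"

definition pdx :: "(complex \<times> complex \<Rightarrow> complex ^ 'l) \<Rightarrow> complex \<times> complex \<Rightarrow> complex ^ 'l" where
  "pdx u = (\<lambda>(x, y). \<chi> r. deriv (\<lambda>t. u (t, y) $ r) x)"

definition pdy :: "(complex \<times> complex \<Rightarrow> complex ^ 'l) \<Rightarrow> complex \<times> complex \<Rightarrow> complex ^ 'l" where
  "pdy u = (\<lambda>(x, y). \<chi> r. deriv (\<lambda>t. u (x, t) $ r) y)"

definition op_P ::
  "(complex \<times> complex \<Rightarrow> complex ^ 'l ^ 'l) \<Rightarrow>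
   (complex \<times> complex \<Rightarrow> complex ^ 'l) \<Rightarrow> complex \<times> complex \<Rightarrow> complex ^ 'l::finite" where
  "op_P R u = (\<lambda>p. (pdx ^^ 2) u p + (pdy ^^ 2) u p + R p *v u p)"

text \<open>The condition \<open>i + j + 2 \<le> m\<close> is \<open>i + j \<le> m - 2\<close> without truncated subtraction: for \<open>m = 1\<close>
  there are no lower order terms.\<close>

definition op_Q ::
  "nat \<Rightarrow> (nat \<Rightarrow> complex) \<Rightarrow> (nat \<Rightarrow> nat \<Rightarrow> complex \<times> complex \<Rightarrow> complex ^ 'l ^ 'l) \<Rightarrow>
   (complex \<times> complex \<Rightarrow> complex ^ 'l) \<Rightarrow> complex \<times> complex \<Rightarrow> complex ^ 'l::finite" where
  "op_Q m c S u = (\<lambda>p.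
     (\<Sum>i\<le>m. c i *s (pdx ^^ (m - i)) ((pdy ^^ i) u) p) +
     (\<Sum>(i, j) \<in> {(i, j). i + j + 2 \<le> m}. S i j p *v (pdx ^^ i) ((pdy ^^ j) u) p))"

text \<open>\<open>[A, B] = 0\<close> for differential operators with coefficients holomorphic on the open set \<open>U\<close>,
  acting on \<open>\<complex>\<^sup>\<ell>\<close>-valued holomorphic functions on \<open>U\<close>.\<close>

definition commute_on ::
  "(complex \<times> complex) set \<Rightarrow>
   ((complex \<times> complex \<Rightarrow> complex ^ 'l) \<Rightarrow> complex \<times> complex \<Rightarrow> complex ^ 'l) \<Rightarrow>
   ((complex \<times> complex \<Rightarrow> complex ^ 'l) \<Rightarrow> complex \<times> complex \<Rightarrow> complex ^ 'l) \<Rightarrow> bool" where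
  "commute_on U A B \<longleftrightarrow> (\<forall>u. holo2_vec U u \<longrightarrow> (\<forall>p\<in>U. A (B u) p - B (A u) p = 0))"

text \<open>\<open>\<complex>[\<xi>, \<tau>]\<close> is represented as \<open>\<complex>[\<xi>][\<tau>]\<close>: the inner polynomial variable is \<open>\<xi>\<close>, the outer one \<open>\<tau>\<close>.\<close>

type_synonym bipoly = "complex poly poly"

definition cst :: "complex \<Rightarrow> bipoly" where "cst z = [:[:z:]:]"
definition \<xi> :: bipoly where "\<xi> = [:[:0, 1:]:]"
definition \<tau> :: bipoly where "\<tau> = [:0, 1:]"

definition d_xi :: "bipoly \<Rightarrow> bipoly" where "d_xi f = map_poly pderiv f"
definition d_tau :: "bipoly \<Rightarrow> bipoly" where "d_tau f = pderiv f"

definition symbol_P :: bipoly where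
  "symbol_P = \<xi> ^ 2 + \<tau> ^ 2"

definition symbol_Q :: "nat \<Rightarrow> (nat \<Rightarrow> complex) \<Rightarrow> bipoly" where
  "symbol_Q m c = (\<Sum>i\<le>m. cst (c i) * \<xi> ^ (m - i) * \<tau> ^ i)"

definition polys_in :: "bipoly \<Rightarrow> bipoly set" where
  "polys_in f = {\<Sum>k\<le>n. cst (d k) * f ^ k | (n::nat) (d :: nat \<Rightarrow> complex). True}"

definition symbol_factorization ::
  "nat \<Rightarrow> (nat \<Rightarrow> complex) \<Rightarrow> nat \<Rightarrow> (nat \<Rightarrow> complex) \<Rightarrow> (nat \<Rightarrow> complex) \<Rightarrow> (nat \<Rightarrow> nat) \<Rightarrow> bool" where
  "symbol_factorization m c L a b e \<longleftrightarrow>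
     (\<forall>\<nu><L. (a \<nu>, b \<nu>) \<noteq> (0, 0)) \<and>
     (\<forall>\<nu><L. \<forall>\<mu><L. \<mu> \<noteq> \<nu> \<longrightarrow> a \<nu> * b \<mu> \<noteq> a \<mu> * b \<nu>) \<and>
     (\<forall>\<nu><L. 0 < e \<nu>) \<and> (\<Sum>\<nu><L. e \<nu>) = m \<and>
     \<xi> * d_tau (symbol_Q m c) - \<tau> * d_xi (symbol_Q m c) =
       (\<Prod>\<nu><L. (cst (a \<nu>) * \<xi> - cst (b \<nu>) * \<tau>) ^ e \<nu>)"

definition mat_scale :: "complex \<Rightarrow> complex ^ 'l ^ 'l \<Rightarrow> complex ^ 'l ^ 'l" where
  "mat_scale z A = (\<chi> r s. z * A $ r $ s)"

text \<open>The linear form multiplying the functions of \<open>a x - b y\<close>.  It is \<open>b x + a y\<close>, except when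
  \<open>a\<^sup>2 + b\<^sup>2 = 0\<close>: then \<open>b x + a y\<close> is a multiple of \<open>a x - b y\<close>, and the independent form \<open>a x + b y\<close>
  has to be used instead.  The exception affects only isotropic factors of multiplicity at least 2
  (for multiplicity 1 only the power 0 occurs), and there it is unavoidable:
  \<open>P = \<partial>\<^sub>x\<^sup>2 + \<partial>\<^sub>y\<^sup>2 + (x - \<i> y)\<close> commutes with \<open>Q = (\<partial>\<^sub>x + \<i> \<partial>\<^sub>y)\<^sup>2 + 2 (x + \<i> y)\<close>, the factored polynomial is
  \<open>2 \<i> (\<xi> + \<i> \<tau>)\<^sup>2\<close>, and \<open>x - \<i> y\<close> is not a function of \<open>x + \<i> y\<close>.\<close>

definition transverse_form :: "complex \<Rightarrow> complex \<Rightarrow> complex \<Rightarrow> complex \<Rightarrow> complex" where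
  "transverse_form a b x y = (if a\<^sup>2 + b\<^sup>2 = 0 then a * x + b * y else b * x + a * y)"

end

theory Submission
  imports Defs "HOL-Computational_Algebra.Fundamental_Theorem_Algebra"
begin

text \<open>
  Why the theorem holds.  The coefficients of order \<open>m - 1\<close> in \<open>[P, Q] = 0\<close> involve only the first
  derivatives of \<open>R\<close> and of the coefficients \<open>S\<^sub>i\<^sub>j\<close> with \<open>i + j = m - 2\<close>.  Writing
  \<open>s(\<xi>, \<tau>) = \<Sum> S\<^sub>i\<^sub>j \<xi>\<^sup>i \<tau>\<^sup>j\<close> over these indices and \<open>q = \<sigma>\<^sub>m(Q)\<close>, they say that
  \<open>2 (\<xi> \<partial>\<^sub>x + \<tau> \<partial>\<^sub>y) s = (q\<^sub>\<xi> \<partial>\<^sub>x + q\<^sub>\<tau> \<partial>\<^sub>y) R\<close> as polynomials in \<open>\<xi>\<close> and \<open>\<tau>\<close>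
  (\<open>leading_commutator_relation\<close>).  Replacing \<open>\<xi>\<close> by the operator \<open>\<partial>\<^sub>y\<close> and \<open>\<tau>\<close> by \<open>- \<partial>\<^sub>x\<close> annihilates
  the left hand side and turns the right hand side into \<open>g(\<partial>\<^sub>y, - \<partial>\<^sub>x) R\<close> with
  \<open>g = \<xi> q\<^sub>\<tau> - \<tau> q\<^sub>\<xi>\<close> (\<open>directional_op_rotation_poly_eq_0\<close>).  This eliminates \<open>S\<close>: every entry of the
  potential satisfies the scalar equation with constant coefficients \<open>g(\<partial>\<^sub>y, - \<partial>\<^sub>x) R = 0\<close>.

  A factor \<open>a \<xi> - b \<tau>\<close> of \<open>g\<close> becomes the derivative \<open>a \<partial>\<^sub>y + b \<partial>\<^sub>x\<close> in the direction \<open>(b, a)\<close>, whose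
  kernel on a convex set consists of the holomorphic functions of \<open>a x - b y\<close>
  (\<open>function_of_lin\<close>).  The factors are removed one at a time: if the derivative of \<open>f\<close> along one of
  the directions is already a sum of the required shape, that sum has an antiderivative \<open>h\<close> of the
  required shape, and \<open>f - h\<close> is in the kernel of a single directional derivative
  (\<open>superposition_kernel\<close>).  Terms with a different direction are integrated by taking primitives of
  functions of one variable; a term with the same direction is integrated by raising the power of the
  transverse linear form, which is where the powers below the multiplicity come from.

  The form \<open>g\<close> is the derivative of \<open>q\<close> along the rotation field, so it vanishes only for rotation
  invariant \<open>q\<close>, that is, for \<open>q\<close> in \<open>\<complex>[\<sigma>(P)]\<close>
  (\<open>rotation_poly_eq_0_imp_symbol_in_polys\<close>).  Otherwise it is a nonzero binary form and splits into
  linear factors over the complex numbers.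

  All of this uses derivatives of arbitrary order of functions that are merely assumed complex
  differentiable, and the symmetry of mixed derivatives; both follow from one-variable Cauchy theory
  (\<open>holo2_dx\<close>, \<open>dx_dy_commute\<close>).
\<close>

section \<open>Holomorphic functions of two variables\<close>

text \<open>\<open>pdx\<close> and \<open>pdy\<close> act on each component separately, so all analysis is done for scalar functions.\<close>

definition dx :: "(complex \<times> complex \<Rightarrow> complex) \<Rightarrow> complex \<times> complex \<Rightarrow> complex" where
  "dx f = (\<lambda>(x, y). deriv (\<lambda>t. f (t, y)) x)"

definition dy :: "(complex \<times> complex \<Rightarrow> complex) \<Rightarrow> complex \<times> complex \<Rightarrow> complex" where
  "dy f = (\<lambda>(x, y). deriv (\<lambda>t. f (x, t)) y)"

lemma dy_swap: "dy f = dx (f \<circ> prod.swap) \<circ> prod.swap"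
  by (auto simp: dx_def dy_def fun_eq_iff)

lemma open_slice_x: "open U \<Longrightarrow> open {t. (t, y) \<in> U}"
  using open_vimage[of U "\<lambda>t. (t, y)"] by (simp add: vimage_def continuous_on_Pair)

lemma open_slice_y: "open U \<Longrightarrow> open {t. (x, t) \<in> U}"
  using open_vimage[of U "\<lambda>t. (x, t)"] by (simp add: vimage_def continuous_on_Pair)

lemma open_swap:
  fixes U :: "('a::topological_space \<times> 'b::topological_space) set"
  shows "open U \<Longrightarrow> open (prod.swap -` U)"
  by (rule open_vimage) (simp_all add: continuous_on_swap)

lemma cball_times_cball_subset_open:
  assumes "open U" "(x, y) \<in> (U :: ('a::metric_space \<times> 'b::metric_space) set)"
  obtains r where "0 < r" "cball x r \<times> cball y r \<subseteq> U"
proof -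
  obtain A B where AB: "open A" "open B" "x \<in> A" "y \<in> B" "A \<times> B \<subseteq> U"
    using open_prod_elim[OF assms] by (metis mem_Times_iff fst_conv snd_conv)
  obtain r1 where r1: "0 < r1" "cball x r1 \<subseteq> A" using AB open_contains_cball by blast
  obtain r2 where r2: "0 < r2" "cball y r2 \<subseteq> B" using AB open_contains_cball by blast
  have "cball x (min r1 r2) \<times> cball y (min r1 r2) \<subseteq> A \<times> B"
    using r1 r2 by (intro Sigma_mono) auto
  then show thesis using that[of "min r1 r2"] r1 r2 AB by auto
qed

lemma holo2_has_dx:
  assumes "holo2 U f" "(x, y) \<in> U"
  shows "((\<lambda>t. f (t, y)) has_field_derivative dx f (x, y)) (at x)"
proof -
  obtain \<alpha> \<beta> where d: "(f has_derivative (\<lambda>(h, k). \<alpha> * h + \<beta> * k)) (at (x, y))"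
    using assms unfolding holo2_def by blast
  have "((\<lambda>t. (t, y)) has_derivative (\<lambda>h. (h, 0))) (at x)"
    by (auto intro!: derivative_eq_intros)
  from has_derivative_compose[OF this d]
  have "((\<lambda>t. f (t, y)) has_derivative (\<lambda>h. \<alpha> * h)) (at x)" by simp
  then have "((\<lambda>t. f (t, y)) has_field_derivative \<alpha>) (at x)"
    by (simp add: has_field_derivative_def)
  then show ?thesis by (simp add: dx_def DERIV_imp_deriv)
qed

lemma holo2_swap:
  assumes "holo2 U f"
  shows "holo2 (prod.swap -` U) (f \<circ> prod.swap)"
  unfolding holo2_def
proof
  fix q :: "complex \<times> complex" assume q: "q \<in> prod.swap -` U"
  obtain \<alpha> \<beta> where d: "(f has_derivative (\<lambda>(h, k). \<alpha> * h + \<beta> * k)) (at (prod.swap q))"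
    using assms q unfolding holo2_def by blast
  have "(prod.swap has_derivative prod.swap) (at q)"
    by (auto simp: prod.swap_def[abs_def] intro!: derivative_eq_intros)
  from has_derivative_compose[OF this d]
  have "((\<lambda>x. f (prod.swap x)) has_derivative (\<lambda>z. case prod.swap z of (h, k) \<Rightarrow> \<alpha> * h + \<beta> * k)) (at q)" .
  moreover have "(\<lambda>z. case prod.swap z of (h, k) \<Rightarrow> \<alpha> * h + \<beta> * k) = (\<lambda>(h, k). \<beta> * h + \<alpha> * k)"
    by (auto simp: fun_eq_iff)
  ultimately show "\<exists>\<alpha> \<beta>. (f \<circ> prod.swap has_derivative (\<lambda>(h, k). \<alpha> * h + \<beta> * k)) (at q)"
    unfolding o_def by metis
qed

lemma holo2_has_dy:
  assumes "holo2 U f" "(x, y) \<in> U"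
  shows "((\<lambda>t. f (x, t)) has_field_derivative dy f (x, y)) (at y)"
  using holo2_has_dx[OF holo2_swap[OF assms(1)], of y x] assms(2) by (simp add: dy_swap)

lemma holo2_continuous_on: "holo2 U f \<Longrightarrow> continuous_on U f"
  unfolding holo2_def
  by (meson continuous_at_imp_continuous_on has_derivative_continuous)

text \<open>Continuity in \<open>y\<close> is the point: Cauchy's inequality bounds the derivative of
  \<open>t \<mapsto> f (t, y) - f (t, y0)\<close> by the values of this difference on a circle, and those are small by
  uniform continuity of \<open>f\<close> on a closed bidisc.  Differentiability is required in \<open>x\<close> only, because
  the lemma is also applied to \<open>dy f\<close> before \<open>dy f\<close> is known to be jointly differentiable.\<close>

lemma continuous_on_dx:
  assumes U: "open U" and cont: "continuous_on U f"
    and diff: "\<And>x y. (x, y) \<in> U \<Longrightarrow> (\<lambda>t. f (t, y)) field_differentiable at x"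
  shows "continuous_on U (dx f)"
proof (rule continuous_at_imp_continuous_on, safe)
  fix x0 y0 assume p: "(x0, y0) \<in> U"
  obtain R where R: "0 < R" "cball x0 R \<times> cball y0 R \<subseteq> U"
    using cball_times_cball_subset_open[OF U p] .
  define r where "r = R / 2"
  have r: "0 < r" using R by (simp add: r_def)
  have holo: "(\<lambda>t. f (t, s)) holomorphic_on cball x0 R" if "s \<in> cball y0 R" for s
    using that R diff unfolding holomorphic_on_def
    by (meson field_differentiable_at_within mem_Sigma_iff subsetD)
  have uc: "uniformly_continuous_on (cball x0 R \<times> cball y0 R) f"
    using R cont by (intro compact_uniformly_continuous compact_Times continuous_on_subset[OF cont]) auto
  have "isCont (deriv (\<lambda>t. f (t, y0))) x0"
    using R holo[of y0]
    by (intro continuous_on_interior[where S="ball x0 R"] holomorphic_on_imp_continuous_on holomorphic_deriv)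
      (auto intro: holomorphic_on_subset)
  then have c0: "((\<lambda>x. dx f (x, y0)) \<longlongrightarrow> dx f (x0, y0)) (at x0)"
    by (simp add: dx_def isCont_def)
  show "isCont (dx f) (x0, y0)"
    unfolding continuous_at_eps_delta
  proof (intro allI impI)
    fix e :: real assume e: "0 < e"
    obtain d1 where d1: "0 < d1" "\<And>x. dist x x0 < d1 \<Longrightarrow> dist (dx f (x, y0)) (dx f (x0, y0)) < e / 2"
    proof -
      have "\<exists>d>0. \<forall>x. dist x x0 < d \<longrightarrow> dist (dx f (x, y0)) (dx f (x0, y0)) < e / 2"
        using c0 half_gt_zero[OF e] unfolding LIM_def isCont_def[symmetric] by (metis dist_self)
      then show thesis using that by blast
    qed
    have "0 < e * r / 2" using e r by simp
    then obtain d2 where d2: "0 < d2" "\<And>z w. z \<in> cball x0 R \<times> cball y0 R \<Longrightarrow> w \<in> cball x0 R \<times> cball y0 R \<Longrightarrow>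
        dist w z < d2 \<Longrightarrow> dist (f w) (f z) < e * r / 2"
      using uc unfolding uniformly_continuous_on_def by meson
    define d where "d = Min {d1, d2, r}"
    have d: "0 < d" "d \<le> d1" "d \<le> d2" "d \<le> r" using d1 d2 r by (auto simp: d_def)
    have "dist (dx f (x, y)) (dx f (x0, y0)) < e" if "dist (x, y) (x0, y0) < d" for x y
    proof -
      have xd: "dist x x0 < d" using that dist_fst_le[of "(x, y)" "(x0, y0)"] by simp
      have yd: "dist y y0 < d" using that dist_snd_le[of "(x, y)" "(x0, y0)"] by simp
      have yR: "y \<in> cball y0 R" "y0 \<in> cball y0 R" using yd d R by (auto simp: r_def dist_commute)
      have sub: "cball x r \<subseteq> cball x0 R"
      proof
        fix t assume "t \<in> cball x r"
        then have "dist x0 t \<le> dist x0 x + dist x t" "dist x t \<le> r" by (auto intro: dist_triangle)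
        then show "t \<in> cball x0 R" using xd d by (simp add: r_def dist_commute)
      qed
      let ?g = "\<lambda>t. f (t, y) - f (t, y0)"
      have hol: "?g holomorphic_on cball x r"
        using holomorphic_on_subset[OF holo sub] yR by (intro holomorphic_intros) auto
      have "norm ((deriv ^^ 1) ?g x) \<le> fact 1 * (e * r / 2) / r ^ 1"
      proof (rule Cauchy_inequality)
        show "?g holomorphic_on ball x r" using hol holomorphic_on_subset ball_subset_cball by blast
        show "continuous_on (cball x r) ?g" using hol holomorphic_on_imp_continuous_on by blast
        show "0 < r" by fact
        fix t assume t: "norm (x - t) = r"
        then have "t \<in> cball x0 R" using sub by (auto simp: dist_norm)
        moreover have "dist (t, y) (t, y0) < d2" using yd d by (simp add: dist_Pair_Pair)
        ultimately have "dist (f (t, y)) (f (t, y0)) < e * r / 2" using d2 yR by auto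
        then show "norm (?g t) \<le> e * r / 2" by (simp add: dist_norm)
      qed
      moreover have "deriv ?g x = dx f (x, y) - dx f (x, y0)"
      proof -
        have "x \<in> ball x0 R" using xd d r by (auto simp: dist_commute r_def)
        then have "(\<lambda>t. f (t, s)) field_differentiable at x" if "s \<in> cball y0 R" for s
          using holo[OF that] holomorphic_on_imp_differentiable_at[of _ "ball x0 R" x]
            holomorphic_on_subset[of _ "cball x0 R" "ball x0 R"] by auto
        then show ?thesis using yR by (simp add: deriv_diff dx_def)
      qed
      ultimately have "norm (dx f (x, y) - dx f (x, y0)) \<le> e / 2" using r by simp
      moreover have "dist (dx f (x, y0)) (dx f (x0, y0)) < e / 2" using d1 xd d by simp
      ultimately show ?thesis
        using dist_triangle[of "dx f (x, y)" "dx f (x0, y0)" "dx f (x, y0)"] by (simp add: dist_norm)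
    qed
    then show "\<exists>d>0. \<forall>x'. dist x' (x0, y0) < d \<longrightarrow> dist (dx f x') (dx f (x0, y0)) < e"
      using d(1) by (metis surj_pair)
  qed
qed

lemma holo2_continuous_on_dx:
  "open U \<Longrightarrow> holo2 U f \<Longrightarrow> continuous_on U (dx f)"
  by (rule continuous_on_dx) (auto intro: holo2_continuous_on holo2_has_dx simp: field_differentiable_def)

lemma holo2_continuous_on_dy:
  assumes "open U" "holo2 U f" shows "continuous_on U (dy f)"
proof -
  have "continuous_on (prod.swap -` U) (dx (f \<circ> prod.swap))"
    using assms by (intro holo2_continuous_on_dx open_swap holo2_swap)
  then show ?thesis unfolding dy_swap
    by (rule continuous_on_compose[rotated, OF continuous_on_subset]) (auto simp: continuous_on_swap)
qed

text \<open>The difference quotients of \<open>f\<close> in the first variable are holomorphic in the second one and converge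
  to \<open>dx f\<close> uniformly on a disc, by the mean value inequality and the continuity of \<open>dx f\<close>.  Hence (Weierstrass)
  their derivatives converge to the derivative of the limit.  These derivatives are the
  difference quotients of \<open>dy f\<close>, so one argument shows that \<open>dx f\<close> is holomorphic in \<open>y\<close>, that \<open>dy f\<close>
  is holomorphic in \<open>x\<close>, and that the mixed derivatives agree.\<close>

lemma dx_has_dy:
  assumes U: "open U" and f: "holo2 U f" and p: "(x, y) \<in> U"
  shows "((\<lambda>s. dx f (x, s)) has_field_derivative dx (dy f) (x, y)) (at y)"
    and "(\<lambda>t. dy f (t, y)) field_differentiable at x"
proof -
  obtain R where R: "0 < R" "cball x R \<times> cball y R \<subseteq> U"
    using cball_times_cball_subset_open[OF U p] .
  have inU: "(t, s) \<in> U" if "dist x t \<le> R" "dist y s \<le> R" for t s using that R by auto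
  define q where "q = (\<lambda>h s. (f (x + h, s) - f (x, s)) / h)"
  define q' where "q' = (\<lambda>h s. (dy f (x + h, s) - dy f (x, s)) / h)"
  have small: "\<forall>\<^sub>F h in at (0::complex). h \<noteq> 0 \<and> norm h < R"
    using R(1) by (auto simp: eventually_at)
  have qd: "((q h) has_field_derivative q' h s) (at s)" if "norm h < R" "dist y s \<le> R" for h s
    unfolding q_def q'_def divide_inverse
    by (intro DERIV_mult DERIV_diff holo2_has_dy[OF f] DERIV_cmult_right inU) (use that R(1) in \<open>auto simp: dist_norm\<close>)
  have uc: "uniformly_continuous_on (cball x R \<times> cball y R) (dx f)"
    by (intro compact_uniformly_continuous compact_Times continuous_on_subset[OF holo2_continuous_on_dx[OF U f]]) (use R in auto)
  have ul: "uniform_limit (cball y R) q (\<lambda>s. dx f (x, s)) (at 0)"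
  proof (rule uniform_limitI)
    fix e :: real assume e: "0 < e"
    then have e2: "0 < e/2" by simp
    then obtain d where d: "0 < d" "\<And>z w. z \<in> cball x R \<times> cball y R \<Longrightarrow> w \<in> cball x R \<times> cball y R \<Longrightarrow>
        dist w z < d \<Longrightarrow> dist (dx f w) (dx f z) < e/2"
      using uc unfolding uniformly_continuous_on_def by meson
    have "dist (q h s) (dx f (x, s)) < e" if h: "h \<noteq> 0" "norm h < min d R" and s: "s \<in> cball y R" for h s
    proof -
      let ?g = "\<lambda>t. f (t, s) - dx f (x, s) * t"
      have "norm (?g (x + h) - ?g x) \<le> e/2 * norm (x + h - x)"
      proof (rule field_differentiable_bound[of "cball x (norm h)" ?g "\<lambda>t. dx f (t, s) - dx f (x, s)"])
        fix t assume t: "t \<in> cball x (norm h)"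
        show "(?g has_field_derivative dx f (t, s) - dx f (x, s)) (at t within cball x (norm h))"
        proof (rule has_field_derivative_at_within, rule DERIV_diff)
          show "((\<lambda>t. f (t, s)) has_field_derivative dx f (t, s)) (at t)"
            using t s h by (intro holo2_has_dx[OF f] inU) auto
          show "((\<lambda>t. dx f (x, s) * t) has_field_derivative dx f (x, s)) (at t)"
            by (rule DERIV_cmult_Id)
        qed
        have "dist (t, s) (x, s) < d" using t h by (simp add: dist_Pair_Pair dist_commute)
        then have "dist (dx f (t, s)) (dx f (x, s)) < e/2" using t h s R by (intro d) auto
        then show "norm (dx f (t, s) - dx f (x, s)) \<le> e/2" by (simp add: dist_norm)
      qed (auto simp: dist_norm)
      moreover have "?g (x + h) - ?g x = h * (q h s - dx f (x, s))"
        using h by (simp add: q_def field_simps)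
      ultimately have "norm h * norm (q h s - dx f (x, s)) \<le> norm h * (e/2)"
        by (simp add: norm_mult mult.commute)
      then show ?thesis using h e by (simp add: dist_norm)
    qed
    then show "\<forall>\<^sub>F h in at 0. \<forall>s\<in>cball y R. dist (q h s) (dx f (x, s)) < e"
      unfolding eventually_at using d R by (intro exI[of _ "min d R"]) auto
  qed
  have "\<forall>\<^sub>F h in at 0. continuous_on (cball y R) (q h) \<and> (\<forall>w\<in>ball y R. (q h has_field_derivative q' h w) (at w))"
    using small
  proof eventually_elim
    case (elim h)
    then show ?case
      by (auto intro!: continuous_at_imp_continuous_on qd DERIV_isCont[OF qd])
  qed
  from has_complex_derivative_uniform_limit[OF this ul _ R(1)] obtain g' where
    g': "\<And>w. w \<in> ball y R \<Longrightarrow> ((\<lambda>s. dx f (x, s)) has_field_derivative g' w) (at w) \<and> ((\<lambda>n. q' n w) \<longlongrightarrow> g' w) (at 0)"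
    by auto
  have "((\<lambda>h. q' h y) \<longlongrightarrow> g' y) (at 0)" using g' R by simp
  then have D: "((\<lambda>t. dy f (t, y)) has_field_derivative g' y) (at x)"
    by (simp add: q'_def DERIV_def)
  then show "(\<lambda>t. dy f (t, y)) field_differentiable at x" by (auto simp: field_differentiable_def)
  have "dx (dy f) (x, y) = g' y" using D by (simp add: dx_def DERIV_imp_deriv)
  then show "((\<lambda>s. dx f (x, s)) has_field_derivative dx (dy f) (x, y)) (at y)" using g' R by simp
qed

lemma dx_dy_commute: "open U \<Longrightarrow> holo2 U f \<Longrightarrow> p \<in> U \<Longrightarrow> dy (dx f) p = dx (dy f) p"
  by (cases p) (auto simp: dy_def intro!: DERIV_imp_deriv dx_has_dy(1)[unfolded dy_def])

text \<open>Only one partial derivative has to be continuous: this is what can be verified for \<open>dx f\<close>, whose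
  \<open>y\<close>-derivative is an \<open>x\<close>-derivative of a continuous function by symmetry.\<close>

lemma holo2I:
  assumes U: "open U" and dfx: "\<And>x y. (x, y) \<in> U \<Longrightarrow> (\<lambda>t. f (t, y)) field_differentiable at x"
    and dfy: "\<And>x y. (x, y) \<in> U \<Longrightarrow> ((\<lambda>t. f (x, t)) has_field_derivative g (x, y)) (at y)"
    and cont: "continuous_on U g"
  shows "holo2 U f"
  unfolding holo2_def
proof safe
  fix x y assume p: "(x, y) \<in> U"
  obtain R where R: "0 < R" "cball x R \<times> cball y R \<subseteq> U"
    using cball_times_cball_subset_open[OF U p] .
  let ?X = "ball x R" and ?Y = "ball y R"
  have XY: "?X \<times> ?Y \<subseteq> U" using R by (auto simp: subset_iff)
  obtain \<alpha> where a: "((\<lambda>t. f (t, y)) has_field_derivative \<alpha>) (at x)"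
    using dfx[OF p] by (auto simp: field_differentiable_def)
  define G where "G = (\<lambda>x y. blinfun_mult_left (g (x, y)))"
  have Gapp: "blinfun_apply (G x y) = (*) (g (x, y))" for x y
    by (auto simp: G_def fun_eq_iff mult.commute)
  have "((\<lambda>(x, y). f (x, y)) has_derivative (\<lambda>(tx, ty). (\<alpha> * tx) + blinfun_apply (G x y) ty)) (at (x, y) within ?X \<times> ?Y)"
  proof (rule has_derivative_partialsI)
    show "((\<lambda>x. f (x, y)) has_derivative (*) \<alpha>) (at x within ball x R)"
      using a by (simp add: has_field_derivative_def has_derivative_at_withinI)
    show "((\<lambda>y. f (x', y)) has_derivative blinfun_apply (G x' y')) (at y' within ?Y)"
      if "x' \<in> ?X" "y' \<in> ?Y" for x' y'
      using that XY dfy[of x' y'] unfolding Gapp has_field_derivative_def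
      by (auto intro!: has_derivative_at_withinI simp: subset_iff)
    have "continuous (at (x, y)) g"
      using cont U p continuous_on_eq_continuous_at by blast
    then have "continuous (at (x, y)) (\<lambda>z. blinfun_mult_left (g z))"
      by (intro bounded_linear.continuous[OF bounded_linear_blinfun_mult_left])
    then show "continuous (at (x, y) within ?X \<times> ?Y) (\<lambda>(x, y). G x y)"
      unfolding G_def by (auto intro: continuous_at_imp_continuous_within simp: case_prod_unfold)
  qed (use R in auto)
  then have "(f has_derivative (\<lambda>(h, k). \<alpha> * h + g (x, y) * k)) (at (x, y) within ?X \<times> ?Y)"
    by (simp add: Gapp case_prod_unfold)
  moreover have "at (x, y) within ?X \<times> ?Y = at (x, y)"
    using R by (intro at_within_open) (auto intro: open_Times)
  ultimately show "\<exists>\<alpha> \<beta>. (f has_derivative (\<lambda>(h, k). \<alpha> * h + \<beta> * k)) (at (x, y))" by metis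
qed

lemma slice_holomorphic_x: "holo2 U f \<Longrightarrow> (\<lambda>t. f (t, y)) holomorphic_on {t. (t, y) \<in> U}"
  unfolding holomorphic_on_def field_differentiable_def
  by (metis holo2_has_dx has_field_derivative_at_within mem_Collect_eq)

lemma slice_holomorphic_y: "holo2 U f \<Longrightarrow> (\<lambda>t. f (x, t)) holomorphic_on {t. (x, t) \<in> U}"
  unfolding holomorphic_on_def field_differentiable_def
  by (metis holo2_has_dy has_field_derivative_at_within mem_Collect_eq)

text \<open>The partial derivative of \<open>dx f\<close> in the second variable is \<open>dx (dy f)\<close>, the \<open>x\<close>-derivative of a
  continuous function that is holomorphic in \<open>x\<close>; so it is continuous, and \<open>holo2I\<close> applies.\<close>

lemma holo2_dx:
  assumes U: "open U" and f: "holo2 U f" shows "holo2 U (dx f)"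
proof (rule holo2I[OF U])
  fix x y assume p: "(x, y) \<in> U"
  have "deriv (\<lambda>t. f (t, y)) holomorphic_on {t. (t, y) \<in> U}"
    by (intro holomorphic_deriv slice_holomorphic_x[OF f] open_slice_x[OF U])
  then show "(\<lambda>t. dx f (t, y)) field_differentiable at x"
    using p holomorphic_on_imp_differentiable_at[OF _ open_slice_x[OF U, of y]] by (auto simp: dx_def)
  show "((\<lambda>s. dx f (x, s)) has_field_derivative dx (dy f) (x, y)) (at y)"
    by (rule dx_has_dy(1)[OF U f p])
next
  show "continuous_on U (dx (dy f))"
    by (rule continuous_on_dx[OF U holo2_continuous_on_dy[OF U f] dx_has_dy(2)[OF U f]])
qed

lemma holo2_dy:
  assumes U: "open U" and f: "holo2 U f" shows "holo2 U (dy f)"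
proof -
  have "holo2 (prod.swap -` (prod.swap -` U)) (dx (f \<circ> prod.swap) \<circ> prod.swap)"
    by (intro holo2_swap holo2_dx open_swap U f)
  then show ?thesis by (simp add: dy_swap vimage_comp[symmetric] vimage_def)
qed

section \<open>Calculus of the partial derivatives\<close>

text \<open>Functions are total, whereas identities between them are known on \<open>U\<close> only; the following lemmas
  allow such identities to be differentiated.\<close>

lemma dx_cong:
  assumes "open U" "\<And>p. p \<in> U \<Longrightarrow> f p = g p" "p \<in> U" shows "dx f p = dx g p"
proof -
  obtain x y where p: "p = (x, y)" by (cases p)
  have "\<forall>\<^sub>F t in nhds x. t \<in> {t. (t, y) \<in> U}"
    using assms p by (intro eventually_nhds_in_open open_slice_x) auto
  then have "\<forall>\<^sub>F t in nhds x. f (t, y) = g (t, y)"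
    by eventually_elim (simp add: assms)
  then show ?thesis by (simp add: p dx_def deriv_cong_ev)
qed

lemma dy_cong:
  assumes "open U" "\<And>p. p \<in> U \<Longrightarrow> f p = g p" "p \<in> U" shows "dy f p = dy g p"
  using dx_cong[OF open_swap[OF assms(1)], of "f \<circ> prod.swap" "g \<circ> prod.swap" "prod.swap p"] assms(2,3)
  by (simp add: dy_swap)

lemma iter_dx_cong:
  assumes "open U" "\<And>p. p \<in> U \<Longrightarrow> f p = g p" "p \<in> U" shows "(dx ^^ n) f p = (dx ^^ n) g p"
  using assms(3) by (induction n arbitrary: p) (auto simp: assms(2) intro: dx_cong[OF assms(1)])

lemma iter_dy_cong:
  assumes "open U" "\<And>p. p \<in> U \<Longrightarrow> f p = g p" "p \<in> U" shows "(dy ^^ n) f p = (dy ^^ n) g p"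
  using assms(3) by (induction n arbitrary: p) (auto simp: assms(2) intro: dy_cong[OF assms(1)])

lemma holo2_iter_dx: "open U \<Longrightarrow> holo2 U f \<Longrightarrow> holo2 U ((dx ^^ n) f)"
  by (induction n) (auto intro: holo2_dx)

lemma holo2_iter_dy: "open U \<Longrightarrow> holo2 U f \<Longrightarrow> holo2 U ((dy ^^ n) f)"
  by (induction n) (auto intro: holo2_dy)

lemma holo2_const [simp]: "holo2 U (\<lambda>_. c)"
  unfolding holo2_def by (intro ballI exI[of _ 0]) (simp add: case_prod_unfold)

lemma holo2_add:
  assumes "holo2 U f" "holo2 U g" shows "holo2 U (\<lambda>p. f p + g p)"
  unfolding holo2_def
proof
  fix p assume p: "p \<in> U"
  obtain a b where f: "(f has_derivative (\<lambda>(h, k). a * h + b * k)) (at p)"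
    using assms(1) p unfolding holo2_def by blast
  obtain a' b' where g: "(g has_derivative (\<lambda>(h, k). a' * h + b' * k)) (at p)"
    using assms(2) p unfolding holo2_def by blast
  show "\<exists>\<alpha> \<beta>. ((\<lambda>p. f p + g p) has_derivative (\<lambda>(h, k). \<alpha> * h + \<beta> * k)) (at p)"
    by (rule exI[of _ "a + a'"], rule exI[of _ "b + b'"], rule has_derivative_eq_rhs[OF has_derivative_add[OF f g]])
      (auto simp: fun_eq_iff algebra_simps)
qed

lemma holo2_mult:
  assumes "holo2 U f" "holo2 U g" shows "holo2 U (\<lambda>p. f p * g p)"
  unfolding holo2_def
proof
  fix p assume p: "p \<in> U"
  obtain a b where f: "(f has_derivative (\<lambda>(h, k). a * h + b * k)) (at p)"
    using assms(1) p unfolding holo2_def by blast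
  obtain a' b' where g: "(g has_derivative (\<lambda>(h, k). a' * h + b' * k)) (at p)"
    using assms(2) p unfolding holo2_def by blast
  show "\<exists>\<alpha> \<beta>. ((\<lambda>p. f p * g p) has_derivative (\<lambda>(h, k). \<alpha> * h + \<beta> * k)) (at p)"
    by (rule exI[of _ "f p * a' + a * g p"], rule exI[of _ "f p * b' + b * g p"],
        rule has_derivative_eq_rhs[OF has_derivative_mult[OF f g]])
      (auto simp: fun_eq_iff algebra_simps)
qed

lemma holo2_cmult: "holo2 U f \<Longrightarrow> holo2 U (\<lambda>p. c * f p)"
  by (intro holo2_mult holo2_const)

lemma holo2_sum: "(\<And>i. i \<in> I \<Longrightarrow> holo2 U (f i)) \<Longrightarrow> holo2 U (\<lambda>p. \<Sum>i\<in>I. f i p)"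
  by (induction I rule: infinite_finite_induct) (auto intro: holo2_add)

lemma holo2_power: "holo2 U f \<Longrightarrow> holo2 U (\<lambda>p. f p ^ n)"
  by (induction n) (auto intro: holo2_mult)

lemma holo2_linear: "holo2 U (\<lambda>(x, y). a * x + b * y)"
  unfolding holo2_def
  by (intro ballI exI[of _ a] exI[of _ b]) (auto simp: case_prod_unfold intro!: derivative_eq_intros)

lemma holo2_compose:
  assumes "\<And>p. p \<in> U \<Longrightarrow> F field_differentiable at (g p)" "holo2 U g"
  shows "holo2 U (\<lambda>p. F (g p))"
  unfolding holo2_def
proof
  fix p assume p: "p \<in> U"
  obtain a b where g: "(g has_derivative (\<lambda>(h, k). a * h + b * k)) (at p)"
    using assms(2) p unfolding holo2_def by blast
  obtain c where "(F has_derivative (*) c) (at (g p))"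
    using assms(1)[OF p] by (auto simp: field_differentiable_def has_field_derivative_def)
  from has_derivative_compose[OF g this]
  show "\<exists>\<alpha> \<beta>. ((\<lambda>p. F (g p)) has_derivative (\<lambda>(h, k). \<alpha> * h + \<beta> * k)) (at p)"
    by (intro exI[of _ "c * a"] exI[of _ "c * b"]) (auto elim!: has_derivative_eq_rhs simp: fun_eq_iff algebra_simps)
qed

lemma dx_eqI: "((\<lambda>t. f (t, y)) has_field_derivative D) (at x) \<Longrightarrow> dx f (x, y) = D"
  by (simp add: dx_def DERIV_imp_deriv)

lemma dy_eqI: "((\<lambda>t. f (x, t)) has_field_derivative D) (at y) \<Longrightarrow> dy f (x, y) = D"
  by (simp add: dy_def DERIV_imp_deriv)

lemma dx_add: "holo2 U f \<Longrightarrow> holo2 U g \<Longrightarrow> p \<in> U \<Longrightarrow> dx (\<lambda>p. f p + g p) p = dx f p + dx g p"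
  by (cases p) (simp, intro dx_eqI DERIV_add holo2_has_dx[of U])

lemma dy_add: "holo2 U f \<Longrightarrow> holo2 U g \<Longrightarrow> p \<in> U \<Longrightarrow> dy (\<lambda>p. f p + g p) p = dy f p + dy g p"
  by (cases p) (simp, intro dy_eqI DERIV_add holo2_has_dy[of U])

lemma dx_cmult: "holo2 U f \<Longrightarrow> p \<in> U \<Longrightarrow> dx (\<lambda>p. c * f p) p = c * dx f p"
  by (cases p) (simp, intro dx_eqI DERIV_cmult holo2_has_dx[of U])

lemma dy_cmult: "holo2 U f \<Longrightarrow> p \<in> U \<Longrightarrow> dy (\<lambda>p. c * f p) p = c * dy f p"
  by (cases p) (simp, intro dy_eqI DERIV_cmult holo2_has_dy[of U])

lemma iter_dx_add:
  assumes U: "open U" and f: "holo2 U f" "holo2 U g" and p: "p \<in> U"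
  shows "(dx ^^ n) (\<lambda>p. f p + g p) p = (dx ^^ n) f p + (dx ^^ n) g p"
  using p
proof (induction n arbitrary: p)
  case (Suc n)
  have "dx ((dx ^^ n) (\<lambda>p. f p + g p)) p = dx (\<lambda>p. (dx ^^ n) f p + (dx ^^ n) g p) p"
    by (rule dx_cong[OF U Suc.IH Suc.prems])
  then show ?case using Suc.prems by (simp add: dx_add[OF holo2_iter_dx[OF U f(1)] holo2_iter_dx[OF U f(2)]])
qed simp

lemma iter_dy_add:
  assumes U: "open U" and f: "holo2 U f" "holo2 U g" and p: "p \<in> U"
  shows "(dy ^^ n) (\<lambda>p. f p + g p) p = (dy ^^ n) f p + (dy ^^ n) g p"
  using p
proof (induction n arbitrary: p)
  case (Suc n)
  have "dy ((dy ^^ n) (\<lambda>p. f p + g p)) p = dy (\<lambda>p. (dy ^^ n) f p + (dy ^^ n) g p) p"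
    by (rule dy_cong[OF U Suc.IH Suc.prems])
  then show ?case using Suc.prems by (simp add: dy_add[OF holo2_iter_dy[OF U f(1)] holo2_iter_dy[OF U f(2)]])
qed simp

lemma iter_dx_cmult:
  assumes U: "open U" and f: "holo2 U f" and p: "p \<in> U"
  shows "(dx ^^ n) (\<lambda>p. c * f p) p = c * (dx ^^ n) f p"
  using p
proof (induction n arbitrary: p)
  case 0 show ?case by (simp only: funpow_0)
next
  case (Suc n)
  have "dx ((dx ^^ n) (\<lambda>p. c * f p)) p = dx (\<lambda>p. c * (dx ^^ n) f p) p"
  proof (rule dx_cong[OF U _ Suc.prems])
    fix q assume "q \<in> U"
    then show "(dx ^^ n) (\<lambda>p. c * f p) q = c * (dx ^^ n) f q" by (rule Suc.IH)
  qed
  also have "\<dots> = c * dx ((dx ^^ n) f) p"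
    using holo2_iter_dx[OF U f] Suc.prems by (rule dx_cmult)
  finally show ?case by (simp only: funpow.simps o_apply)
qed

lemma iter_dy_cmult:
  assumes U: "open U" and f: "holo2 U f" and p: "p \<in> U"
  shows "(dy ^^ n) (\<lambda>p. c * f p) p = c * (dy ^^ n) f p"
  using p
proof (induction n arbitrary: p)
  case 0 show ?case by (simp only: funpow_0)
next
  case (Suc n)
  have "dy ((dy ^^ n) (\<lambda>p. c * f p)) p = dy (\<lambda>p. c * (dy ^^ n) f p) p"
  proof (rule dy_cong[OF U _ Suc.prems])
    fix q assume "q \<in> U"
    then show "(dy ^^ n) (\<lambda>p. c * f p) q = c * (dy ^^ n) f q" by (rule Suc.IH)
  qed
  also have "\<dots> = c * dy ((dy ^^ n) f) p"
    using holo2_iter_dy[OF U f] Suc.prems by (rule dy_cmult)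
  finally show ?case by (simp only: funpow.simps o_apply)
qed

text \<open>The order of differentiation is that of the terms of \<open>Q\<close>.\<close>

definition dxy :: "nat \<Rightarrow> nat \<Rightarrow> (complex \<times> complex \<Rightarrow> complex) \<Rightarrow> complex \<times> complex \<Rightarrow> complex" where
  "dxy i j f = (dx ^^ i) ((dy ^^ j) f)"

lemma dxy_cong: "open U \<Longrightarrow> (\<And>p. p \<in> U \<Longrightarrow> f p = g p) \<Longrightarrow> p \<in> U \<Longrightarrow> dxy i j f p = dxy i j g p"
  unfolding dxy_def by (intro iter_dx_cong iter_dy_cong)

lemma dxy_add:
  assumes U: "open U" and f: "holo2 U f" "holo2 U g" and p: "p \<in> U"
  shows "dxy i j (\<lambda>p. f p + g p) p = dxy i j f p + dxy i j g p"
  unfolding dxy_def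
  by (subst iter_dx_cong[OF U iter_dy_add[OF U f] p])
    (auto simp: iter_dx_add[OF U holo2_iter_dy[OF U f(1)] holo2_iter_dy[OF U f(2)] p])

lemma dxy_cmult:
  assumes U: "open U" and f: "holo2 U f" and p: "p \<in> U"
  shows "dxy i j (\<lambda>p. c * f p) p = c * dxy i j f p"
  unfolding dxy_def
  by (subst iter_dx_cong[OF U iter_dy_cmult[OF U f] p])
    (auto simp: iter_dx_cmult[OF U holo2_iter_dy[OF U f(1)] p])

lemma dxy_const_0 [simp]: "dxy i j (\<lambda>_. 0) p = 0"
  using dxy_cmult[of UNIV "\<lambda>_. 0" p i j 0] by simp

lemma dxy_sum:
  assumes U: "open U" and f: "\<And>k. k \<in> I \<Longrightarrow> holo2 U (f k)" and p: "p \<in> U"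
  shows "dxy i j (\<lambda>p. \<Sum>k\<in>I. f k p) p = (\<Sum>k\<in>I. dxy i j (f k) p)"
  using f by (induction I rule: infinite_finite_induct) (auto simp: dxy_add[OF U _ _ p] holo2_sum)

lemma iter_dy_dx:
  assumes U: "open U" and f: "holo2 U f" and p: "p \<in> U"
  shows "(dy ^^ n) (dx f) p = dx ((dy ^^ n) f) p"
  using p
proof (induction n arbitrary: p)
  case (Suc n)
  have "dy ((dy ^^ n) (dx f)) p = dy (dx ((dy ^^ n) f)) p"
    by (rule dy_cong[OF U Suc.IH Suc.prems])
  also have "\<dots> = dx (dy ((dy ^^ n) f)) p"
    by (rule dx_dy_commute[OF U holo2_iter_dy[OF U f] Suc.prems])
  finally show ?case by simp
qed simp

lemma dxy_dx:
  assumes U: "open U" and f: "holo2 U f" and p: "p \<in> U"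
  shows "dxy i j (dx f) p = dxy (Suc i) j f p"
  unfolding dxy_def by (subst iter_dx_cong[OF U iter_dy_dx[OF U f] p]) (auto simp: funpow_swap1)

lemma dxy_dy: "dxy i j (dy f) p = dxy i (Suc j) f p"
  by (simp add: dxy_def funpow_swap1)

section \<open>The leading coefficients of the commutator\<close>

text \<open>The falling factorial \<open>n (n - 1) \<cdots> (n - k + 1)\<close>.  It occurs in two ways: as the factor of the
  \<open>k\<close>-th derivative of an \<open>n\<close>-th power, and as the factor of the \<open>n\<close>-th derivative, at the zero of
  the power, of a product with a \<open>k\<close>-th power.\<close>

definition ffact :: "nat \<Rightarrow> nat \<Rightarrow> complex" where
  "ffact n k = of_nat (fact k * (n choose k))"

lemma ffact_0 [simp]: "ffact n 0 = 1" by (simp add: ffact_def)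
lemma ffact_same: "ffact n n = fact n" by (simp add: ffact_def)
lemma ffact_gt [simp]: "n < k \<Longrightarrow> ffact n k = 0" by (simp add: ffact_def)

lemma ffact_Suc: "ffact n (Suc k) = ffact n k * of_nat (n - k)"
proof -
  have "Suc k * (n choose Suc k) = (n - k) * (n choose k)"
    by (simp only: binomial_absorb_comp binomial_absorption)
  then have "fact k * (Suc k * (n choose Suc k)) = fact k * ((n - k) * (n choose k))" by simp
  then have "fact (Suc k) * (n choose Suc k) = fact k * (n choose k) * (n - k)" by (simp only: fact_Suc mult_ac of_nat_id)
  then show ?thesis unfolding ffact_def of_nat_mult[symmetric] by (rule arg_cong)
qed

lemma ffact_fact: "k \<le> n \<Longrightarrow> ffact n k * fact (n - k) = fact n"
proof -
  assume "k \<le> n"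
  then have "of_nat (fact k * fact (n - k) * (n choose k)) = (of_nat (fact n) :: complex)"
    by (subst binomial_fact_lemma) auto
  then show ?thesis by (simp add: ffact_def mult_ac)
qed

lemma higher_deriv_shifted_power:
  "(deriv ^^ i) (\<lambda>z. (z - z0) ^ a) = (\<lambda>z. ffact a i * (z - z0) ^ (a - i))"
proof (induction i)
  case (Suc i)
  have "deriv (\<lambda>z. ffact a i * (z - z0) ^ (a - i)) z = ffact a (Suc i) * (z - z0) ^ (a - Suc i)" for z
    by (rule DERIV_imp_deriv) (auto intro!: derivative_eq_intros simp: ffact_Suc)
  then show ?case using Suc by auto
qed simp

text \<open>In the Leibniz formula at \<open>z0\<close> only the summand survives in which the power is differentiated exactly
  \<open>a\<close> times.\<close>

lemma higher_deriv_shifted_power_mult: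
  assumes S: "open S" "z0 \<in> S" and g: "g holomorphic_on S"
  shows "(deriv ^^ k) (\<lambda>z. (z - z0) ^ a * g z) z0 = ffact k a * (deriv ^^ (k - a)) g z0"
proof -
  have "(deriv ^^ k) (\<lambda>z. (z - z0) ^ a * g z) z0 =
    (\<Sum>i=0..k. of_nat (k choose i) * (deriv ^^ i) (\<lambda>z. (z - z0) ^ a) z0 * (deriv ^^ (k - i)) g z0)"
    by (rule higher_deriv_mult[OF _ g S]) (intro holomorphic_intros)
  also have "\<dots> = (\<Sum>i=0..k. if i = a then ffact k a * (deriv ^^ (k - a)) g z0 else 0)"
  proof (intro sum.cong refl)
    fix i
    consider "i = a" | "i > a" | "i < a" by linarith
    then show "of_nat (k choose i) * (deriv ^^ i) (\<lambda>z. (z - z0) ^ a) z0 * (deriv ^^ (k - i)) g z0 =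
      (if i = a then ffact k a * (deriv ^^ (k - a)) g z0 else 0)"
      by cases (auto simp: higher_deriv_shifted_power ffact_same ffact_def)
  qed
  also have "\<dots> = ffact k a * (deriv ^^ (k - a)) g z0" by (auto simp: sum.delta)
  finally show ?thesis .
qed

lemma dx_apply: "dx f (x, y) = deriv (\<lambda>t. f (t, y)) x"
  by (simp add: dx_def)

lemma dy_apply: "dy f (x, y) = deriv (\<lambda>t. f (x, t)) y"
  by (simp add: dy_def)

lemma pdx_apply: "pdx u (x, y) $ r = deriv (\<lambda>t. u (t, y) $ r) x"
  by (simp add: pdx_def)

lemma pdy_apply: "pdy u (x, y) $ r = deriv (\<lambda>t. u (x, t) $ r) y"
  by (simp add: pdy_def)

lemma iter_dx_slice: "(dx ^^ n) f (x, y) = (deriv ^^ n) (\<lambda>t. f (t, y)) x"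
proof (induction n arbitrary: x)
  case (Suc n)
  have "(\<lambda>t. (dx ^^ n) f (t, y)) = (deriv ^^ n) (\<lambda>t. f (t, y))" using Suc by auto
  then show ?case by (simp add: dx_apply)
qed simp

lemma iter_dy_slice: "(dy ^^ n) f (x, y) = (deriv ^^ n) (\<lambda>t. f (x, t)) y"
proof (induction n arbitrary: y)
  case (Suc n)
  have "(\<lambda>t. (dy ^^ n) f (x, t)) = (deriv ^^ n) (\<lambda>t. f (x, t))" using Suc by auto
  then show ?case by (simp add: dy_apply)
qed simp

text \<open>The test functions to which the commutator is applied: evaluated at the centre \<open>(x0, y0)\<close>, a
  differential operator applied to \<open>mon x0 y0 a b\<close> yields \<open>a! b!\<close> times its coefficient of
  \<open>\<partial>\<^sub>x\<^sup>a \<partial>\<^sub>y\<^sup>b\<close>.\<close>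

definition mon :: "complex \<Rightarrow> complex \<Rightarrow> nat \<Rightarrow> nat \<Rightarrow> complex \<times> complex \<Rightarrow> complex" where
  "mon x0 y0 a b = (\<lambda>(x, y). (x - x0) ^ a * (y - y0) ^ b)"

lemma mon_at_base: "mon x0 y0 a b (x0, y0) = (if a = 0 \<and> b = 0 then 1 else 0)"
  by (auto simp: mon_def)

lemma holo2_mon: "holo2 U (mon x0 y0 a b)"
proof -
  have "holo2 U (\<lambda>p. ((case p of (x, y) \<Rightarrow> 1 * x + 0 * y) + - x0) ^ a * ((case p of (x, y) \<Rightarrow> 0 * x + 1 * y) + - y0) ^ b)"
    by (rule holo2_mult; rule holo2_power; rule holo2_add; rule holo2_linear holo2_const)
  then show ?thesis by (simp add: mon_def case_prod_unfold)
qed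

lemma dxy_mon: "dxy i j (mon x0 y0 a b) = (\<lambda>p. ffact a i * ffact b j * mon x0 y0 (a - i) (b - j) p)"
proof
  fix p :: "complex \<times> complex"
  obtain x y where p: "p = (x, y)" by (cases p)
  have "(dy ^^ j) (mon x0 y0 a b) (x, y) = (ffact b j * (y - y0) ^ (b - j)) * (x - x0) ^ a" for x y
    using higher_deriv_cmult[of "\<lambda>s. (s - y0) ^ b" UNIV y j "(x - x0) ^ a"]
    by (simp add: iter_dy_slice mon_def higher_deriv_shifted_power holomorphic_intros)
  then have "(dx ^^ i) ((dy ^^ j) (mon x0 y0 a b)) (x, y) =
      (deriv ^^ i) (\<lambda>t. (ffact b j * (y - y0) ^ (b - j)) * (t - x0) ^ a) x"
    by (simp add: iter_dx_slice)
  also have "\<dots> = (ffact b j * (y - y0) ^ (b - j)) * (deriv ^^ i) (\<lambda>t. (t - x0) ^ a) x"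
    by (rule higher_deriv_cmult[of _ UNIV]) (auto intro!: holomorphic_intros)
  finally show "dxy i j (mon x0 y0 a b) p = ffact a i * ffact b j * mon x0 y0 (a - i) (b - j) p"
    by (simp add: p dxy_def higher_deriv_shifted_power mon_def mult_ac)
qed

lemma dxy_mon_mult:
  assumes U: "open U" and f: "holo2 U f" and p: "(x0, y0) \<in> U"
  shows "dxy k l (\<lambda>p. mon x0 y0 a b p * f p) (x0, y0) = ffact k a * ffact l b * dxy (k - a) (l - b) f (x0, y0)"
proof -
  let ?S = "{t. (t, y0) \<in> U}"
  let ?g = "\<lambda>t. ffact l b * (dy ^^ (l - b)) f (t, y0)"
  have oS: "open ?S" by (rule open_slice_x[OF U])
  have ghol: "?g holomorphic_on ?S"
    by (intro holomorphic_intros slice_holomorphic_x holo2_iter_dy U f)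
  have inner: "(dy ^^ l) (\<lambda>p. mon x0 y0 a b p * f p) (t, y0) = (t - x0) ^ a * ?g t" if t: "t \<in> ?S" for t
  proof -
    let ?T = "{s. (t, s) \<in> U}"
    have T: "open ?T" "y0 \<in> ?T" "(\<lambda>s. f (t, s)) holomorphic_on ?T"
      using t open_slice_y[OF U] slice_holomorphic_y[OF f] by auto
    have "(dy ^^ l) (\<lambda>p. mon x0 y0 a b p * f p) (t, y0) =
        (deriv ^^ l) (\<lambda>s. (t - x0) ^ a * ((s - y0) ^ b * f (t, s))) y0"
      by (simp add: iter_dy_slice mon_def mult.assoc)
    also have "\<dots> = (t - x0) ^ a * (deriv ^^ l) (\<lambda>s. (s - y0) ^ b * f (t, s)) y0"
      by (rule higher_deriv_cmult[of _ ?T]) (use T in \<open>auto intro!: holomorphic_intros\<close>)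
    also have "(deriv ^^ l) (\<lambda>s. (s - y0) ^ b * f (t, s)) y0 = ffact l b * (deriv ^^ (l - b)) (\<lambda>s. f (t, s)) y0"
      by (rule higher_deriv_shifted_power_mult[OF T])
    finally show ?thesis by (simp add: iter_dy_slice)
  qed
  have "dxy k l (\<lambda>p. mon x0 y0 a b p * f p) (x0, y0) =
      (deriv ^^ k) (\<lambda>t. (dy ^^ l) (\<lambda>p. mon x0 y0 a b p * f p) (t, y0)) x0"
    by (simp add: dxy_def iter_dx_slice)
  also have "\<dots> = (deriv ^^ k) (\<lambda>t. (t - x0) ^ a * ?g t) x0"
  proof (rule higher_deriv_transform_within_open[OF _ _ oS])
    show "(\<lambda>t. (dy ^^ l) (\<lambda>p. mon x0 y0 a b p * f p) (t, y0)) holomorphic_on ?S"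
      by (intro slice_holomorphic_x holo2_iter_dy U holo2_mult holo2_mon f)
    show "(\<lambda>t. (t - x0) ^ a * ?g t) holomorphic_on ?S" by (intro holomorphic_intros ghol)
  qed (use p inner in auto)
  also have "\<dots> = ffact k a * (deriv ^^ (k - a)) ?g x0"
    by (rule higher_deriv_shifted_power_mult[OF oS _ ghol]) (use p in simp)
  also have "(deriv ^^ (k - a)) ?g x0 = ffact l b * (deriv ^^ (k - a)) (\<lambda>t. (dy ^^ (l - b)) f (t, y0)) x0"
    by (rule higher_deriv_cmult[OF _ _ oS]) (use p in \<open>auto intro!: slice_holomorphic_x holo2_iter_dy U f\<close>)
  finally show ?thesis by (simp add: dxy_def iter_dx_slice)
qed

lemma pdx_iter_nth: "(pdx ^^ n) u p $ r = (dx ^^ n) (\<lambda>p. u p $ r) p"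
proof (induction n arbitrary: p)
  case (Suc n)
  have "(\<lambda>t. (pdx ^^ n) u (t, snd p) $ r) = (\<lambda>t. (dx ^^ n) (\<lambda>p. u p $ r) (t, snd p))" using Suc by auto
  then show ?case by (cases p) (simp add: pdx_apply dx_apply)
qed simp

lemma pdy_iter_nth: "(pdy ^^ n) u p $ r = (dy ^^ n) (\<lambda>p. u p $ r) p"
proof (induction n arbitrary: p)
  case (Suc n)
  have "(\<lambda>t. (pdy ^^ n) u (fst p, t) $ r) = (\<lambda>t. (dy ^^ n) (\<lambda>p. u p $ r) (fst p, t))" using Suc by auto
  then show ?case by (cases p) (simp add: pdy_apply dy_apply)
qed simp

lemma pdx_pdy_iter_nth: "(pdx ^^ i) ((pdy ^^ j) u) p $ r = dxy i j (\<lambda>p. u p $ r) p"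
  by (simp add: pdx_iter_nth pdy_iter_nth dxy_def)

lemma op_P_nth:
  "op_P R u p $ r = dxy 2 0 (\<lambda>p. u p $ r) p + dxy 0 2 (\<lambda>p. u p $ r) p + (\<Sum>s\<in>UNIV. R p $ r $ s * u p $ s)"
  unfolding op_P_def vector_add_component pdx_iter_nth pdy_iter_nth
  by (simp add: dxy_def matrix_vector_mult_def)

lemma op_Q_nth:
  "op_Q m c S u p $ r = (\<Sum>i\<le>m. c i * dxy (m - i) i (\<lambda>p. u p $ r) p) +
    (\<Sum>(i, j)\<in>{(i, j). i + j + 2 \<le> m}. \<Sum>s\<in>UNIV. S i j p $ r $ s * dxy i j (\<lambda>p. u p $ s) p)"
  by (simp add: op_Q_def case_prod_unfold matrix_vector_mult_def pdx_pdy_iter_nth)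

lemma finite_lower_order_indices: "finite {(i, j). i + j + 2 \<le> (m::nat)}"
  by (rule finite_subset[of _ "{..m} \<times> {..m}"]) auto

text \<open>The coefficient of \<open>\<partial>\<^sub>x\<^sup>a \<partial>\<^sub>y\<^sup>b\<close> in \<open>[P, Q]\<close> for \<open>a + b = m - 1\<close>, extracted by applying \<open>[P, Q]\<close> to the
  monomial of bidegree \<open>(a, b)\<close> centred at \<open>p\<close>, in the component \<open>s\<close>.  Terms of \<open>P Q\<close> and \<open>Q P\<close> in which
  the monomial is differentiated to any order other than \<open>(a, b)\<close> vanish at \<open>p\<close>.  What remains are the terms
  in which the Laplacian differentiates a leading coefficient of \<open>S\<close> once, the terms in which the leading
  part of \<open>Q\<close> differentiates \<open>R\<close> once, and the products of coefficients of \<open>S\<close> of order \<open>m - 3\<close> with the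
  Laplacian, which occur in \<open>P Q\<close> and in \<open>Q P\<close> and cancel.\<close>

lemma leading_commutator_relation:
  fixes R :: "complex \<times> complex \<Rightarrow> complex ^ 'l ^ 'l::finite"
  assumes U: "open U" and R: "holo2_mat U R"
    and S: "\<And>i j. i + j + 2 \<le> m \<Longrightarrow> holo2_mat U (S i j)"
    and comm: "commute_on U (op_P R) (op_Q m c S)"
    and ab: "a + b + 1 = m" and p: "p \<in> U"
  shows "(if 0 < a then 2 * dx (\<lambda>p. S (a - 1) b p $ r $ s) p else 0) +
    (if 0 < b then 2 * dy (\<lambda>p. S a (b - 1) p $ r $ s) p else 0) =
    of_nat (Suc a) * c b * dx (\<lambda>p. R p $ r $ s) p + of_nat (Suc b) * c (Suc b) * dy (\<lambda>p. R p $ r $ s) p"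
proof -
  obtain x0 y0 where p0: "p = (x0, y0)" by (cases p)
  let ?I = "{(i, j). i + j + 2 \<le> m}"
  let ?mon = "mon x0 y0"
  note fin = finite_lower_order_indices[of m]
  have Rh: "holo2 U (\<lambda>p. R p $ i $ j)" for i j using R by (simp add: holo2_mat_def)
  have Sh: "holo2 U (\<lambda>p. S i j p $ k $ l)" if "i + j + 2 \<le> m" for i j k l
    using S[OF that] by (simp add: holo2_mat_def)
  define u :: "complex \<times> complex \<Rightarrow> complex ^ 'l" where "u = (\<lambda>p. \<chi> t. if t = s then ?mon a b p else 0)"
  have ut: "(\<lambda>p. u p $ t) = (if t = s then ?mon a b else (\<lambda>_. 0))" for t by (auto simp: u_def)
  have du: "dxy i j (\<lambda>p. u p $ t) q = (if t = s then ffact a i * ffact b j * ?mon (a - i) (b - j) q else 0)" for i j t q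
    by (simp add: ut dxy_mon)
  have hu: "holo2_vec U u" by (simp add: holo2_vec_def ut holo2_mon)
  have base: "?mon k l p = (if k = 0 \<and> l = 0 then 1 else 0)" for k l unfolding p0 by (rule mon_at_base)
  have Qu: "op_Q m c S u q $ t =
      (\<Sum>(i, j)\<in>?I. ?mon (a - i) (b - j) q * ((ffact a i * ffact b j) * S i j q $ t $ s))" for q t
  proof -
    have "(\<Sum>i\<le>m. c i * dxy (m - i) i (\<lambda>p. u p $ t) q) = 0"
    proof (rule sum.neutral, rule ballI)
      fix i assume "i \<in> {..m}"
      then have "a < m - i \<or> b < i" using ab by auto
      then show "c i * dxy (m - i) i (\<lambda>p. u p $ t) q = 0" by (auto simp: du)
    qed
    then show ?thesis
      by (simp add: op_Q_nth du if_distrib[of "\<lambda>x. _ * x"] sum.delta mult_ac cong: if_cong)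
  qed
  \<comment> \<open>The lower order part of \<open>Q\<close> does not differentiate the monomial often enough to be nonzero at \<open>p\<close>;
    so the potential does not contribute to \<open>P (Q u)\<close>.\<close>
  have Qu0: "op_Q m c S u p $ t = 0" for t
    unfolding Qu
  proof (rule sum.neutral, clarify)
    fix i j assume "i + j + 2 \<le> m"
    then have "a - i \<noteq> 0 \<or> b - j \<noteq> 0" using ab by auto
    then show "?mon (a - i) (b - j) p * (ffact a i * ffact b j * S i j p $ t $ s) = 0" by (auto simp: base)
  qed
  have dQu: "dxy k l (\<lambda>q. op_Q m c S u q $ r) p =
      (\<Sum>(i, j)\<in>?I. ffact k (a - i) * ffact l (b - j) * ((ffact a i * ffact b j) * dxy (k - (a - i)) (l - (b - j)) (\<lambda>p. S i j p $ r $ s) p))"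
    for k l
  proof -
    have "dxy k l (\<lambda>q. op_Q m c S u q $ r) p =
      dxy k l (\<lambda>q. \<Sum>z\<in>?I. ?mon (a - fst z) (b - snd z) q * ((ffact a (fst z) * ffact b (snd z)) * S (fst z) (snd z) q $ r $ s)) p"
      by (simp add: Qu case_prod_unfold)
    also have "\<dots> = (\<Sum>z\<in>?I. dxy k l (\<lambda>q. ?mon (a - fst z) (b - snd z) q * ((ffact a (fst z) * ffact b (snd z)) * S (fst z) (snd z) q $ r $ s)) p)"
      by (rule dxy_sum[OF U _ p]) (auto intro!: holo2_mult holo2_mon Sh)
    also have "\<dots> = (\<Sum>z\<in>?I. ffact k (a - fst z) * ffact l (b - snd z) * 
        ((ffact a (fst z) * ffact b (snd z)) * dxy (k - (a - fst z)) (l - (b - snd z)) (\<lambda>p. S (fst z) (snd z) p $ r $ s) p))"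
    proof (intro sum.cong refl)
      fix z assume "z \<in> ?I"
      then have h: "holo2 U (\<lambda>q. S (fst z) (snd z) q $ r $ s)" by (auto intro: Sh)
      show "dxy k l (\<lambda>q. ?mon (a - fst z) (b - snd z) q * ((ffact a (fst z) * ffact b (snd z)) * S (fst z) (snd z) q $ r $ s)) p =
        ffact k (a - fst z) * ffact l (b - snd z) * 
        ((ffact a (fst z) * ffact b (snd z)) * dxy (k - (a - fst z)) (l - (b - snd z)) (\<lambda>p. S (fst z) (snd z) p $ r $ s) p)"
        unfolding p0 dxy_mon_mult[OF U holo2_cmult[OF h] p[unfolded p0]]
        by (simp only: dxy_cmult[OF U h p[unfolded p0]])
    qed
    finally show ?thesis by (simp add: case_prod_unfold)
  qed
  have Pu: "(\<lambda>q. op_P R u q $ t) = (\<lambda>q. (if t = s then 1 else 0) * (ffact a 2 * ?mon (a - 2) b q + ffact b 2 * ?mon a (b - 2) q)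
      + ?mon a b q * R q $ t $ s)" for t
  proof
    fix q
    have "(\<Sum>k\<in>UNIV. R q $ t $ k * u q $ k) = ?mon a b q * R q $ t $ s"
      by (simp add: u_def if_distrib[of "\<lambda>x. _ * x"] sum.delta mult.commute cong: if_cong)
    then show "op_P R u q $ t = (if t = s then 1 else 0) * (ffact a 2 * ?mon (a - 2) b q + ffact b 2 * ?mon a (b - 2) q)
      + ?mon a b q * R q $ t $ s"
      by (simp add: op_P_nth du)
  qed
  have dPu: "dxy i j (\<lambda>q. op_P R u q $ t) p =
      (if t = s then 1 else 0) * (ffact a 2 * (ffact (a - 2) i * ffact b j * ?mon (a - 2 - i) (b - j) p) +
        ffact b 2 * (ffact a i * ffact (b - 2) j * ?mon (a - i) (b - 2 - j) p)) +
      ffact i a * ffact j b * dxy (i - a) (j - b) (\<lambda>p. R p $ t $ s) p" for i j t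
  proof -
    have h: "holo2 U (\<lambda>q. ffact a 2 * ?mon (a - 2) b q)" "holo2 U (\<lambda>q. ffact b 2 * ?mon a (b - 2) q)"
      "holo2 U (\<lambda>q. ?mon a b q * R q $ t $ s)"
      by (intro holo2_cmult holo2_mult holo2_mon Rh)+
    note h2 = holo2_add[OF h(1,2)]
    show ?thesis
      unfolding Pu dxy_add[OF U holo2_cmult[OF h2] h(3) p] dxy_cmult[OF U h2 p] dxy_add[OF U h(1,2) p]
        dxy_cmult[OF U holo2_mon p] dxy_mon
      by (simp add: p0 dxy_mon_mult[OF U Rh p[unfolded p0]])
  qed
  have "op_P R (op_Q m c S u) p $ r = op_Q m c S (op_P R u) p $ r"
    using comm hu p unfolding commute_on_def by (metis eq_iff_diff_eq_0)
  moreover have "op_P R (op_Q m c S u) p $ r = dxy 2 0 (\<lambda>q. op_Q m c S u q $ r) p + dxy 0 2 (\<lambda>q. op_Q m c S u q $ r) p"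
    by (simp add: op_P_nth Qu0)
  moreover have "op_Q m c S (op_P R u) p $ r = (\<Sum>i\<le>m. c i * dxy (m - i) i (\<lambda>q. op_P R u q $ r) p) +
    (\<Sum>(i, j)\<in>?I. \<Sum>t\<in>UNIV. S i j p $ r $ t * dxy i j (\<lambda>q. op_P R u q $ t) p)"
    by (rule op_Q_nth)
  moreover have "(\<Sum>i\<le>m. c i * dxy (m - i) i (\<lambda>q. op_P R u q $ r) p) =
    fact a * fact b * (of_nat (Suc a) * c b * dx (\<lambda>p. R p $ r $ s) p + of_nat (Suc b) * c (Suc b) * dy (\<lambda>p. R p $ r $ s) p)"
  proof -
    \<comment> \<open>Here \<open>Q\<close> acts on the Laplacian of the monomial, of degree below \<open>m\<close>, and on \<open>R\<close> times the monomial;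
      only the latter contributes.\<close>
    have top: "c i * dxy (m - i) i (\<lambda>q. op_P R u q $ r) p =
        c i * (ffact (m - i) a * ffact i b * dxy (m - i - a) (i - b) (\<lambda>p. R p $ r $ s) p)" if "i \<le> m" for i
    proof -
      have "a < m - i \<or> b < i" using ab that by auto
      moreover have "b - 2 < i \<or> a < m - i" "a - 2 < m - i \<or> b < i" using ab that by auto
      ultimately have "ffact (a - 2) (m - i) * ffact b i = 0" "ffact a (m - i) * ffact (b - 2) i = 0" by auto
      then show ?thesis by (auto simp: dPu)
    qed
    have "(\<Sum>i\<le>m. c i * dxy (m - i) i (\<lambda>q. op_P R u q $ r) p) =
        (\<Sum>i\<le>m. c i * (ffact (m - i) a * ffact i b * dxy (m - i - a) (i - b) (\<lambda>p. R p $ r $ s) p))"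
      by (intro sum.cong refl top) auto
    also have "\<dots> = (\<Sum>i\<in>{b, Suc b}. c i * (ffact (m - i) a * ffact i b * dxy (m - i - a) (i - b) (\<lambda>p. R p $ r $ s) p))"
    proof (rule sum.mono_neutral_right)
      show "\<forall>i\<in>{..m} - {b, Suc b}. c i * (ffact (m - i) a * ffact i b * dxy (m - i - a) (i - b) (\<lambda>p. R p $ r $ s) p) = 0"
      proof
        fix i assume i: "i \<in> {..m} - {b, Suc b}"
        then have "i < b \<or> m - i < a" using ab by auto
        then show "c i * (ffact (m - i) a * ffact i b * dxy (m - i - a) (i - b) (\<lambda>p. R p $ r $ s) p) = 0" by auto
      qed
    qed (use ab in auto)
    also have "\<dots> = fact a * fact b * (of_nat (Suc a) * c b * dx (\<lambda>p. R p $ r $ s) p + of_nat (Suc b) * c (Suc b) * dy (\<lambda>p. R p $ r $ s) p)"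
    proof -
      have "m - b = Suc a" "m - Suc b = a" "m - (a + b) = 1" using ab by auto
      moreover have "ffact (Suc n) n = of_nat (Suc n) * fact n" for n
        using ffact_fact[of n "Suc n"] by simp
      ultimately show ?thesis by (simp add: ffact_same dxy_def algebra_simps)
    qed
    finally show ?thesis .
  qed
  moreover have "(\<Sum>(i, j)\<in>?I. \<Sum>t\<in>UNIV. S i j p $ r $ t * dxy i j (\<lambda>q. op_P R u q $ t) p) =
    (\<Sum>(i, j)\<in>?I. (if i + 2 = a \<and> j = b then fact a * fact b * S i j p $ r $ s else 0) +
      (if i = a \<and> j + 2 = b then fact a * fact b * S i j p $ r $ s else 0))"
  proof (intro sum.cong refl, clarify)
    fix i j assume ij: "i + j + 2 \<le> m"
    then have "i < a \<or> j < b" using ab by auto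
    \<comment> \<open>The product of \<open>R\<close> with the monomial vanishes at \<open>p\<close> to a higher order than the lower order part of \<open>Q\<close>.\<close>
    then have z: "ffact i a * ffact j b = 0" by auto
    have "(\<Sum>t\<in>UNIV. S i j p $ r $ t * dxy i j (\<lambda>q. op_P R u q $ t) p) =
      S i j p $ r $ s * (ffact a 2 * (ffact (a - 2) i * ffact b j * ?mon (a - 2 - i) (b - j) p) +
        ffact b 2 * (ffact a i * ffact (b - 2) j * ?mon (a - i) (b - 2 - j) p))"
      unfolding dPu z by (simp add: if_distrib[of "\<lambda>x. _ * x"] if_distrib[of "\<lambda>x. x * _"] sum.delta cong: if_cong)
    moreover have "ffact n 2 * ffact (n - 2) k * (if n - 2 - k = 0 then 1 else 0) = (if k + 2 = n then fact n else 0)" for n k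
    proof -
      consider "k + 2 = n" | "n < 2" | "2 \<le> n" "n - 2 < k" | "k < n - 2" by linarith
      then show ?thesis
      proof cases
        case 1
        then show ?thesis using ffact_fact[of 2 n] by (auto simp: ffact_same)
      qed auto
    qed
    note e2 = this
    have e0: "ffact n k * (if n - k = 0 then 1 else 0) = (if k = n then fact n else 0)" for n k
    proof -
      consider "k = n" | "n < k" | "k < n" by linarith
      then show ?thesis by cases (auto simp: ffact_same)
    qed
    have "ffact a 2 * (ffact (a - 2) i * ffact b j * ?mon (a - 2 - i) (b - j) p) =
        (ffact a 2 * ffact (a - 2) i * (if a - 2 - i = 0 then 1 else 0)) * (ffact b j * (if b - j = 0 then 1 else 0))"
      by (simp add: base)
    moreover have "ffact b 2 * (ffact a i * ffact (b - 2) j * ?mon (a - i) (b - 2 - j) p) =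
        (ffact b 2 * ffact (b - 2) j * (if b - 2 - j = 0 then 1 else 0)) * (ffact a i * (if a - i = 0 then 1 else 0))"
      by (simp add: base)
    ultimately show "(\<Sum>t\<in>UNIV. S i j p $ r $ t * dxy i j (\<lambda>q. op_P R u q $ t) p) =
      (if i + 2 = a \<and> j = b then fact a * fact b * S i j p $ r $ s else 0) +
      (if i = a \<and> j + 2 = b then fact a * fact b * S i j p $ r $ s else 0)"
      unfolding e2 e0 by auto
  qed
  moreover have "dxy 2 0 (\<lambda>q. op_Q m c S u q $ r) p + dxy 0 2 (\<lambda>q. op_Q m c S u q $ r) p =
    (\<Sum>(i, j)\<in>?I. (if i + 2 = a \<and> j = b then fact a * fact b * S i j p $ r $ s else 0) +
      (if i = a \<and> j + 2 = b then fact a * fact b * S i j p $ r $ s else 0)) +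
    (\<Sum>(i, j)\<in>?I. (if i + 1 = a \<and> j = b then 2 * fact a * fact b * dx (\<lambda>p. S i j p $ r $ s) p else 0) +
      (if i = a \<and> j + 1 = b then 2 * fact a * fact b * dy (\<lambda>p. S i j p $ r $ s) p else 0))"
    unfolding dQu sum.distrib[symmetric]
  proof (intro sum.cong refl, clarify)
    fix i j assume ij: "i + j + 2 \<le> m"
    have g2: "ffact 2 (n - k) * ffact n k = (if k + 1 = n then 2 * fact n else if k + 2 = n then fact n else if k = n then fact n else 0)" for n k
    proof -
      consider "k + 1 = n" | "k + 2 = n" | "k = n" | "n < k" | "2 < n - k" by linarith
      then show ?thesis
      proof cases
        case 1
        then have "n - k = 1" "ffact n k = fact n" using ffact_fact[of k n] by auto
        moreover have "ffact 2 1 = 2" by (simp add: ffact_def)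
        ultimately show ?thesis using 1 by simp
      next
        case 2
        then have "n - k = 2" by simp
        then show ?thesis using 2 ffact_fact[of k n] by (simp add: ffact_same mult.commute)
      qed (auto simp: ffact_same)
    qed
    have g0: "ffact 0 (n - k) * ffact n k = (if k = n then fact n else 0)" for n k
    proof -
      consider "k = n" | "n < k" | "0 < n - k" by linarith
      then show ?thesis by cases (auto simp: ffact_same)
    qed
    let ?dx = "dxy (2 - (a - i)) (0 - (b - j)) (\<lambda>p. S i j p $ r $ s) p"
    let ?dy = "dxy (0 - (a - i)) (2 - (b - j)) (\<lambda>p. S i j p $ r $ s) p"
    \<comment> \<open>The index \<open>(a, b)\<close> would contribute a second derivative of \<open>S\<close>, but \<open>S\<close> has no terms of order \<open>m - 1\<close>.\<close>
    have nab: "\<not> (i = a \<and> j = b)" using ij ab by auto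
    have "ffact 2 (a - i) * ffact 0 (b - j) * (ffact a i * ffact b j * ?dx) +
       ffact 0 (a - i) * ffact 2 (b - j) * (ffact a i * ffact b j * ?dy) =
       (ffact 2 (a - i) * ffact a i) * (ffact 0 (b - j) * ffact b j) * ?dx +
       (ffact 0 (a - i) * ffact a i) * (ffact 2 (b - j) * ffact b j) * ?dy" by (simp only: mult_ac)
    also have "\<dots> = (if i + 2 = a \<and> j = b then fact a * fact b * S i j p $ r $ s else 0) +
      (if i = a \<and> j + 2 = b then fact a * fact b * S i j p $ r $ s else 0) +
      ((if i + 1 = a \<and> j = b then 2 * fact a * fact b * dx (\<lambda>p. S i j p $ r $ s) p else 0) +
      (if i = a \<and> j + 1 = b then 2 * fact a * fact b * dy (\<lambda>p. S i j p $ r $ s) p else 0))"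
      unfolding g2 g0 using nab by (auto simp: dxy_def)
    finally show "ffact 2 (a - i) * ffact 0 (b - j) * (ffact a i * ffact b j * ?dx) +
       ffact 0 (a - i) * ffact 2 (b - j) * (ffact a i * ffact b j * ?dy) =
       (if i + 2 = a \<and> j = b then fact a * fact b * S i j p $ r $ s else 0) +
      (if i = a \<and> j + 2 = b then fact a * fact b * S i j p $ r $ s else 0) +
      ((if i + 1 = a \<and> j = b then 2 * fact a * fact b * dx (\<lambda>p. S i j p $ r $ s) p else 0) +
      (if i = a \<and> j + 1 = b then 2 * fact a * fact b * dy (\<lambda>p. S i j p $ r $ s) p else 0))" .
  qed
  moreover have "(\<Sum>(i, j)\<in>?I. (if i + 1 = a \<and> j = b then 2 * fact a * fact b * dx (\<lambda>p. S i j p $ r $ s) p else 0) +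
      (if i = a \<and> j + 1 = b then 2 * fact a * fact b * dy (\<lambda>p. S i j p $ r $ s) p else 0)) =
    fact a * fact b * ((if 0 < a then 2 * dx (\<lambda>p. S (a - 1) b p $ r $ s) p else 0) +
    (if 0 < b then 2 * dy (\<lambda>p. S a (b - 1) p $ r $ s) p else 0))"
  proof -
    have single: "(\<Sum>(i, j)\<in>?I. if i + k = a \<and> j + l = b then X i j else 0) = (if k \<le> a \<and> l \<le> b then X (a - k) (b - l) else 0)"
      if "k + l = 1" for k l and X :: "nat \<Rightarrow> nat \<Rightarrow> complex"
    proof (cases "k \<le> a \<and> l \<le> b")
      case True
      then have mem: "(a - k, b - l) \<in> ?I" using ab that by auto
      have "(\<Sum>(i, j)\<in>?I. if i + k = a \<and> j + l = b then X i j else 0) =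
          (\<Sum>z\<in>?I. if z = (a - k, b - l) then X (a - k) (b - l) else 0)"
        using True by (intro sum.cong refl) (auto split: if_splits)
      also have "\<dots> = X (a - k) (b - l)" using mem fin by (simp add: sum.delta)
      finally show ?thesis using True by simp
    next
      case False
      then have "(\<Sum>(i, j)\<in>?I. if i + k = a \<and> j + l = b then X i j else 0) = 0"
        by (intro sum.neutral) auto
      then show ?thesis by (simp only: if_not_P[OF False])
    qed
    have "(\<Sum>(i, j)\<in>?I. (if i + 1 = a \<and> j = b then 2 * fact a * fact b * dx (\<lambda>p. S i j p $ r $ s) p else 0) +
      (if i = a \<and> j + 1 = b then 2 * fact a * fact b * dy (\<lambda>p. S i j p $ r $ s) p else 0)) =
      (\<Sum>(i, j)\<in>?I. if i + 1 = a \<and> j + 0 = b then 2 * fact a * fact b * dx (\<lambda>p. S i j p $ r $ s) p else 0) +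
      (\<Sum>(i, j)\<in>?I. if i + 0 = a \<and> j + 1 = b then 2 * fact a * fact b * dy (\<lambda>p. S i j p $ r $ s) p else 0)"
      by (simp add: sum.distrib case_prod_unfold)
    also have "\<dots> = (if 1 \<le> a \<and> 0 \<le> b then 2 * fact a * fact b * dx (\<lambda>p. S (a - 1) (b - 0) p $ r $ s) p else 0) +
      (if 0 \<le> a \<and> 1 \<le> b then 2 * fact a * fact b * dy (\<lambda>p. S (a - 0) (b - 1) p $ r $ s) p else 0)"
      by (intro arg_cong2[where f="(+)"] single) simp_all
    finally show ?thesis by (simp add: algebra_simps)
  qed
  ultimately have "fact a * fact b * ((if 0 < a then 2 * dx (\<lambda>p. S (a - 1) b p $ r $ s) p else 0) +
    (if 0 < b then 2 * dy (\<lambda>p. S a (b - 1) p $ r $ s) p else 0)) =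
    fact a * fact b * (of_nat (Suc a) * c b * dx (\<lambda>p. R p $ r $ s) p + of_nat (Suc b) * c (Suc b) * dy (\<lambda>p. R p $ r $ s) p)"
    by (simp only:) (metis (no_types, lifting) add.commute add_left_cancel)
  then show ?thesis by (simp only: mult_cancel_left mult_eq_0_iff fact_nonzero simp_thms)
qed

section \<open>Binary forms and the rotation field\<close>

text \<open>The binary form \<open>\<xi>\<^sup>n p(\<tau> / \<xi>)\<close>.  It transports the factorization of a polynomial in one variable to forms.\<close>

definition homogenize :: "nat \<Rightarrow> complex poly \<Rightarrow> bipoly" where
  "homogenize n p = (\<Sum>k\<le>n. monom (monom (coeff p k) (n - k)) k)"

lemma coeff_homogenize: "coeff (homogenize n p) k = (if k \<le> n then monom (coeff p k) (n - k) else 0)"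
  by (simp add: homogenize_def coeff_sum)

lemma homogenize_inj:
  assumes "homogenize n p = homogenize n q" "degree p \<le> n" "degree q \<le> n" shows "p = q"
proof (rule poly_eqI)
  fix k
  show "coeff p k = coeff q k"
  proof (cases "k \<le> n")
    case True
    then have "monom (coeff p k) (n - k) = monom (coeff q k) (n - k)"
      using arg_cong[OF assms(1), of "\<lambda>f. coeff f k"] by (simp add: coeff_homogenize)
    then show ?thesis by simp
  next
    case False
    then show ?thesis using assms by (simp add: coeff_eq_0)
  qed
qed

lemma sum_monom: "(\<Sum>i\<in>I. monom (f i) k) = monom (\<Sum>i\<in>I. f i) k"
  by (induction I rule: infinite_finite_induct) (auto simp: add_monom)

lemma homogenize_mult:
  assumes p: "degree p \<le> j" and q: "degree q \<le> k"
  shows "homogenize (j + k) (p * q) = homogenize j p * homogenize k q"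
proof (rule poly_eqI)
  fix n
  have "coeff (homogenize j p) i * coeff (homogenize k q) (n - i) =
      (if n \<le> j + k then monom (coeff p i * coeff q (n - i)) (j + k - n) else 0)" if "i \<le> n" for i
  proof -
    consider "i > j" | "n - i > k" | "i \<le> j" "n - i \<le> k" by linarith
    then show ?thesis
    proof cases
      case 3
      \<comment> \<open>In the other two cases a coefficient on the left vanishes; here the truncated exponents of \<open>\<xi>\<close> add up.\<close>
      then have "j - i + (k - (n - i)) = j + k - n" "n \<le> j + k" using that by auto
      then show ?thesis using 3 by (simp add: coeff_homogenize mult_monom)
    qed (use p q in \<open>auto simp: coeff_homogenize coeff_eq_0\<close>)
  qed
  then have "coeff (homogenize j p * homogenize k q) n =
      (\<Sum>i\<le>n. if n \<le> j + k then monom (coeff p i * coeff q (n - i)) (j + k - n) else 0)"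
    unfolding coeff_mult by (intro sum.cong) auto
  then show "coeff (homogenize (j + k) (p * q)) n = coeff (homogenize j p * homogenize k q) n"
    by (simp add: coeff_homogenize coeff_mult sum_monom)
qed

lemma homogenize_1: "homogenize 0 1 = 1"
  by (simp add: homogenize_def monom_0 one_pCons)

lemma homogenize_power:
  assumes "degree p \<le> d" shows "homogenize (d * n) (p ^ n) = homogenize d p ^ n"
proof (induction n)
  case 0 then show ?case by (simp add: homogenize_1)
next
  case (Suc n)
  have "degree (p ^ n) \<le> d * n"
    by (rule order.trans[OF degree_power_le]) (use assms in simp)
  then show ?case using homogenize_mult[OF assms, of "p ^ n" "d * n"] Suc by simp
qed

lemma homogenize_prod:
  assumes "finite I" "\<And>i. i \<in> I \<Longrightarrow> degree (f i) \<le> d i"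
  shows "homogenize (\<Sum>i\<in>I. d i) (\<Prod>i\<in>I. f i) = (\<Prod>i\<in>I. homogenize (d i) (f i))"
  using assms
proof (induction I rule: finite_induct)
  case empty then show ?case by (simp add: homogenize_1)
next
  case (insert i I)
  have "degree (\<Prod>i\<in>I. f i) \<le> (\<Sum>i\<in>I. d i)"
    using degree_prod_sum_le[OF insert(1), of f] sum_mono[of I "degree \<circ> f" d] insert.prems by force
  then show ?case using insert homogenize_mult[of "f i" "d i" "\<Prod>i\<in>I. f i"] by simp
qed

lemma homogenize_linear: "homogenize 1 [:a, - b:] = cst a * \<xi> - cst b * \<tau>"
  by (simp add: homogenize_def monom_0 monom_Suc cst_def \<xi>_def \<tau>_def)

lemma homogenize_linear_product:
  "homogenize (\<Sum>\<nu><(L::nat). e \<nu>) (\<Prod>\<nu><L. [:a \<nu>, - b \<nu>:] ^ e \<nu>) =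
    (\<Prod>\<nu><L. (cst (a \<nu>) * \<xi> - cst (b \<nu>) * \<tau>) ^ e \<nu>)"
proof -
  have deg: "degree [:x, - y:] \<le> 1" for x y :: complex by simp
  have "homogenize (\<Sum>\<nu><L. e \<nu>) (\<Prod>\<nu><L. [:a \<nu>, - b \<nu>:] ^ e \<nu>) =
    (\<Prod>\<nu><L. homogenize (e \<nu>) ([:a \<nu>, - b \<nu>:] ^ e \<nu>))"
    by (rule homogenize_prod)
      (auto intro!: order.trans[OF degree_power_le] order.trans[OF mult_right_mono[OF deg]])
  also have "\<dots> = (\<Prod>\<nu><L. (cst (a \<nu>) * \<xi> - cst (b \<nu>) * \<tau>) ^ e \<nu>)"
    using homogenize_power[OF deg] homogenize_linear by simp
  finally show ?thesis .
qed

lemma degree_linear_product: "degree (\<Prod>\<nu><(L::nat). [:a \<nu>, - b \<nu>::complex:] ^ e \<nu>) \<le> (\<Sum>\<nu><L. e \<nu>)"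
proof -
  have deg: "degree [:x, - y:] \<le> 1" for x y :: complex by simp
  have "degree (\<Prod>\<nu><L. [:a \<nu>, - b \<nu>:] ^ e \<nu>) \<le> (\<Sum>\<nu><L. degree ([:a \<nu>, - b \<nu>:] ^ e \<nu>))"
    using degree_prod_sum_le[of "{..<L}" "\<lambda>\<nu>. [:a \<nu>, - b \<nu>:] ^ e \<nu>"] by (simp add: o_def)
  also have "\<dots> \<le> (\<Sum>\<nu><L. e \<nu>)"
    by (intro sum_mono order.trans[OF degree_power_le] order.trans[OF mult_right_mono[OF deg]]) auto
  finally show ?thesis .
qed

text \<open>The polynomial \<open>g(1, t)\<close> for the form \<open>g = \<xi> q\<^sub>\<tau> - \<tau> q\<^sub>\<xi>\<close>, where \<open>q = \<Sum> c\<^sub>k \<xi>\<^sup>m\<^sup>-\<^sup>k \<tau>\<^sup>k\<close>: the coefficient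
  of \<open>t\<^sup>k\<close> is \<open>(k + 1) c\<^sub>k\<^sub>+\<^sub>1 - (m - k + 1) c\<^sub>k\<^sub>-\<^sub>1\<close>, with the boundary terms omitted.\<close>

definition rotation_poly :: "nat \<Rightarrow> (nat \<Rightarrow> complex) \<Rightarrow> complex poly" where
  "rotation_poly m c = (\<Sum>k\<le>m. monom ((if k < m then of_nat (Suc k) * c (Suc k) else 0) -
    (case k of 0 \<Rightarrow> 0 | Suc j \<Rightarrow> of_nat (m - j) * c j)) k)"

lemma coeff_rotation_poly: "coeff (rotation_poly m c) k = (if k \<le> m then
    (if k < m then of_nat (Suc k) * c (Suc k) else 0) - (case k of 0 \<Rightarrow> 0 | Suc j \<Rightarrow> of_nat (m - j) * c j) else 0)"
  by (simp add: rotation_poly_def coeff_sum)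

lemma degree_rotation_poly: "degree (rotation_poly m c) \<le> m"
  by (rule degree_le) (simp add: coeff_rotation_poly)

lemma symbol_Q_homogenize: "symbol_Q m c = homogenize m (\<Sum>i\<le>m. monom (c i) i)"
proof -
  have "cst z * \<xi> ^ j * \<tau> ^ i = monom (monom z j) i" for z i j
  proof -
    have eqs: "\<tau> = monom 1 1" "\<xi> = monom (monom 1 1) 0" "cst z = monom (monom z 0) 0"
      by (simp_all add: \<tau>_def \<xi>_def cst_def monom_0 monom_Suc one_pCons)
    show ?thesis unfolding eqs by (simp add: monom_power mult_monom)
  qed
  then show ?thesis by (simp add: symbol_Q_def homogenize_def coeff_sum)
qed

lemma coeff_symbol_Q: "coeff (symbol_Q m c) i = (if i \<le> m then monom (c i) (m - i) else 0)"
  by (simp add: symbol_Q_homogenize coeff_homogenize coeff_sum)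

lemma rotation_symbol_Q:
  "\<xi> * d_tau (symbol_Q m c) - \<tau> * d_xi (symbol_Q m c) = homogenize m (rotation_poly m c)"
proof (rule poly_eqI)
  fix k
  have X: "coeff (\<xi> * f) k = [:0, 1:] * coeff f k" for f by (simp add: \<xi>_def)
  have T: "coeff (\<tau> * f) k = (case k of 0 \<Rightarrow> 0 | Suc j \<Rightarrow> coeff f j)" for f
    by (simp add: \<tau>_def coeff_pCons)
  have 1: "[:0, 1:] * coeff (d_tau (symbol_Q m c)) k = (if k < m then monom (of_nat (Suc k) * c (Suc k)) (m - k) else 0)"
  proof (cases "k < m")
    case True
    then have "m - k = Suc (m - Suc k)" by simp
    then show ?thesis using True
      by (simp add: d_tau_def coeff_pderiv coeff_symbol_Q monom_Suc of_nat_poly smult_monom del: of_nat_Suc)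
  qed (simp add: d_tau_def coeff_pderiv coeff_symbol_Q)
  have 2: "coeff (d_xi (symbol_Q m c)) j = (if j \<le> m then monom (of_nat (m - j) * c j) (m - Suc j) else 0)" for j
    by (simp add: d_xi_def coeff_map_poly coeff_symbol_Q pderiv_monom)
  show "coeff (\<xi> * d_tau (symbol_Q m c) - \<tau> * d_xi (symbol_Q m c)) k = coeff (homogenize m (rotation_poly m c)) k"
    unfolding coeff_diff X T 1
    by (cases k) (simp_all add: coeff_homogenize coeff_rotation_poly 2 diff_monom minus_monom)
qed

text \<open>Homogenization to a fixed degree is injective, so a factorization of the form restricts to one of the
  polynomial.\<close>

lemma symbol_factorization_rotation_poly:
  "symbol_factorization m c L a b e \<Longrightarrow> rotation_poly m c = (\<Prod>\<nu><L. [:a \<nu>, - b \<nu>:] ^ e \<nu>)"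
  unfolding symbol_factorization_def
  by (rule homogenize_inj[where n=m])
    (auto simp: rotation_symbol_Q homogenize_linear_product[symmetric] degree_rotation_poly degree_linear_product)

text \<open>Vanishing of \<open>g\<close> is a two-step recursion for the coefficients \<open>c\<^sub>k\<close>, with \<open>c\<^sub>1 = 0\<close> at one end and \<open>c\<^sub>m\<^sub>-\<^sub>1 = 0\<close> at the
  other.  The first end kills the odd coefficients.  If \<open>m\<close> is odd, the second end kills the even ones;
  if \<open>m = 2 n\<close>, the recursion is that of the binomial coefficients and gives \<open>c\<^sub>0 (\<xi>\<^sup>2 + \<tau>\<^sup>2)\<^sup>n\<close>.\<close>

lemma rotation_poly_eq_0_imp_symbol_in_polys:
  assumes 0: "rotation_poly m c = 0"
  shows "symbol_Q m c \<in> polys_in symbol_P"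
proof -
  have rec: "(if k < m then of_nat (Suc k) * c (Suc k) else 0) = (case k of 0 \<Rightarrow> 0 | Suc j \<Rightarrow> of_nat (m - j) * c j)"
    if "k \<le> m" for k
    using arg_cong[OF 0, of "\<lambda>p. coeff p k"] that by (simp add: coeff_rotation_poly)
  have step: "of_nat (k + 2) * c (k + 2) = of_nat (m - k) * c k" if "k + 2 \<le> m" for k
    using rec[of "Suc k"] that by simp
  have odd: "2 * j + 1 \<le> m \<Longrightarrow> c (2 * j + 1) = 0" for j
  proof (induction j)
    case 0 then show ?case using rec[of 0] by simp
  next
    case (Suc j)
    then have "of_nat (2 * j + 3) * c (2 * j + 3) = 0" using step[of "2 * j + 1"] by (simp add: numeral_eq_Suc)
    then show ?case by (simp add: numeral_eq_Suc del: of_nat_add of_nat_Suc)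
  qed
  show ?thesis
  proof (cases "even m")
    case False
    then obtain n where m: "m = 2 * n + 1" by (auto elim: oddE)
    have "i \<le> n \<Longrightarrow> c (2 * (n - i)) = 0" for i
    proof (induction i)
      case 0 then show ?case using rec[of m] m by simp
    next
      case (Suc i)
      then have "c (2 * (n - Suc i) + 2) = 0" 
      proof -
        have "2 * (n - Suc i) + 2 = 2 * (n - i)" using Suc.prems by simp
        then show ?thesis using Suc by simp
      qed
      then have "of_nat (m - 2 * (n - Suc i)) * c (2 * (n - Suc i)) = 0"
        using step[of "2 * (n - Suc i)"] m Suc.prems by simp
      moreover have "m - 2 * (n - Suc i) \<noteq> 0" using m by simp
      ultimately show ?case by (simp del: of_nat_diff)
    qed
    then have "c (2 * j) = 0" if "j \<le> n" for j using that by (metis diff_diff_cancel diff_le_self)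
    with odd have "c k = 0" if "k \<le> m" for k using that m by (cases "even k") (auto elim!: evenE oddE)
    then have "symbol_Q m c = (\<Sum>k\<le>(0::nat). cst 0 * symbol_P ^ k)"
      by (simp add: symbol_Q_def cst_def)
    then show ?thesis unfolding polys_in_def by (intro CollectI exI[of _ 0] exI[of _ "\<lambda>_. 0"]) simp
  next
    case True
    then obtain n where m: "m = 2 * n" by (auto elim: evenE)
    have ev: "j \<le> n \<Longrightarrow> c (2 * j) = c 0 * of_nat (n choose j)" for j
    proof (induction j)
      case (Suc j)
      have "of_nat (2 * Suc j) * c (2 * Suc j) = of_nat (2 * (n - j)) * c (2 * j)"
        using step[of "2 * j"] m Suc.prems by (simp add: diff_mult_distrib2)
      then have "2 * (of_nat (Suc j) * c (2 * Suc j)) = 2 * (c 0 * of_nat ((n - j) * (n choose j)))"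
        using Suc by (simp add: algebra_simps)
      then have "of_nat (Suc j) * c (2 * Suc j) = c 0 * of_nat ((n - j) * (n choose j))"
        by (simp only: mult_cancel_left) simp
      also have "(n - j) * (n choose j) = Suc j * (n choose Suc j)"
        by (simp only: binomial_absorb_comp binomial_absorption)
      finally have "of_nat (Suc j) * c (2 * Suc j) = of_nat (Suc j) * (c 0 * of_nat (n choose Suc j))"
        by (simp only: of_nat_mult mult_ac)
      then show ?case by (simp only: mult_cancel_left of_nat_eq_0_iff nat.distinct simp_thms)
    qed simp
    have pow: "[:1, 0, 1:] ^ n = (\<Sum>j\<le>n. monom (of_nat (n choose j)) (2 * j) :: complex poly)"
    proof -
      have "[:1, 0, 1:] = (monom 1 2 + 1 :: complex poly)"
        by (simp add: numeral_2_eq_2 monom_Suc monom_0 one_pCons)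
      then show ?thesis
        by (simp add: binomial_ring monom_power of_nat_monom mult_monom of_nat_mult_conv_smult[symmetric])
    qed
    have "(\<Sum>i\<le>m. monom (c i) i) = smult (c 0) ([:1, 0, 1:] ^ n)"
    proof -
      have "(\<Sum>i\<le>m. monom (c i) i) = (\<Sum>i\<in>(\<lambda>j. 2 * j) ` {..n}. monom (c i) i)"
      proof (rule sum.mono_neutral_right)
        show "\<forall>i\<in>{..m} - (*) 2 ` {..n}. monom (c i) i = 0"
        proof
          fix i assume i: "i \<in> {..m} - (*) 2 ` {..n}"
          then have "odd i" using m by (auto elim!: evenE)
          then obtain j where "i = 2 * j + 1" by (auto elim: oddE)
          then show "monom (c i) i = 0" using odd[of j] i by simp
        qed
      qed (auto simp: m)
      also have "\<dots> = (\<Sum>j\<le>n. monom (c 0 * of_nat (n choose j)) (2 * j))"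
        by (subst sum.reindex) (auto simp: inj_on_def ev)
      finally show ?thesis 
        by (simp add: pow poly_eq_iff coeff_sum sum_distrib_left if_distrib[of "\<lambda>x. c 0 * x"] cong: if_cong)
    qed
    then have "symbol_Q m c = homogenize (0 + 2 * n) ([:c 0:] * [:1, 0, 1:] ^ n)"
      by (simp add: symbol_Q_homogenize m)
    also have "\<dots> = homogenize 0 [:c 0:] * homogenize (2 * n) ([:1, 0, 1:] ^ n)"
      by (rule homogenize_mult) (auto intro!: order.trans[OF degree_power_le])
    also have "homogenize (2 * n) ([:1, 0, 1:] ^ n) = homogenize 2 [:1, 0, 1:] ^ n"
      by (rule homogenize_power) simp
    also have "homogenize 2 [:1, 0, 1:] = symbol_P"
      by (simp add: homogenize_def numeral_2_eq_2 monom_0 monom_Suc symbol_P_def \<xi>_def \<tau>_def one_pCons)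
    also have "homogenize 0 [:c 0:] = cst (c 0)" by (simp add: homogenize_def cst_def monom_0)
    also have "cst (c 0) * symbol_P ^ n = (\<Sum>k\<le>n. if k = n then cst (c 0) * symbol_P ^ k else 0)"
      by (simp add: sum.delta)
    also have "\<dots> = (\<Sum>k\<le>n. cst (if k = n then c 0 else 0) * symbol_P ^ k)"
      by (intro sum.cong) (auto simp: cst_def)
    finally have "symbol_Q m c = (\<Sum>k\<le>n. cst (if k = n then c 0 else 0) * symbol_P ^ k)" .
    then show ?thesis unfolding polys_in_def
      by (intro CollectI exI[of _ n] exI[of _ "\<lambda>k. if k = n then c 0 else 0"]) simp
  qed
qed

text \<open>The fundamental theorem of algebra splits \<open>g(1, t)\<close> into linear factors; if its degree is less than \<open>m\<close>,
  the missing factors are powers of \<open>\<xi>\<close>.\<close>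

lemma symbol_factorization_exists:
  assumes m: "0 < m" and c: "symbol_Q m c \<notin> polys_in symbol_P"
  shows "\<exists>L a b e. symbol_factorization m c L a b e"
proof -
  let ?p = "rotation_poly m c"
  have p0: "?p \<noteq> 0" using c rotation_poly_eq_0_imp_symbol_in_polys by blast
  define Z where "Z = {z. poly ?p z = 0}"
  have fin: "finite Z" unfolding Z_def by (rule poly_roots_finite[OF p0])
  define n where "n = card Z"
  obtain r where r: "bij_betw r {..<n} Z"
    using ex_bij_betw_nat_finite[OF fin] by (auto simp: atLeast0LessThan n_def)
  define d where "d = degree ?p"
  define E where "E = (\<lambda>\<nu>. order (r \<nu>) ?p)"
  have rZ: "r \<nu> \<in> Z" if "\<nu> < n" for \<nu> using r that by (auto simp: bij_betw_def)
  have E: "0 < E \<nu>" if "\<nu> < n" for \<nu>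
    using rZ[OF that] p0 by (simp add: E_def Z_def order_root)
  have dec: "?p = smult (lead_coeff ?p) (\<Prod>\<nu><n. [:- r \<nu>, 1:] ^ E \<nu>)"
  proof -
    have "(\<Prod>\<nu><n. [:- r \<nu>, 1:] ^ E \<nu>) = (\<Prod>z\<in>Z. [:- z, 1:] ^ order z ?p)"
      unfolding E_def by (rule prod.reindex_bij_betw[OF r])
    then show ?thesis using complex_poly_decompose[of ?p] by (simp add: Z_def)
  qed
  have sumE: "(\<Sum>\<nu><n. E \<nu>) = d"
  proof -
    have "d = degree (\<Prod>\<nu><n. [:- r \<nu>, 1:] ^ E \<nu>)"
      unfolding d_def by (subst dec) (simp add: p0)
    also have "\<dots> = (\<Sum>\<nu><n. E \<nu>)"
      by (subst degree_prod_sum_eq) (auto simp: degree_power_eq)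
    finally show ?thesis ..
  qed
  have dm: "d \<le> m" by (simp add: d_def degree_rotation_poly)
  \<comment> \<open>The factorization has no room for a leading constant.  As the exponents sum to \<open>m\<close>, scaling every
    linear form by an \<open>m\<close>-th root of the constant absorbs it.\<close>
  define z where "z = exp (Ln (lead_coeff ?p) / of_nat m)"
  have z: "z ^ m = lead_coeff ?p" using m p0 by (simp add: z_def exp_divide_power_eq)
  have z0: "z \<noteq> 0" by (simp add: z_def)
  define L where "L = (if d < m then Suc n else n)"
  define a where "a = (\<lambda>\<nu>. if \<nu> < n then - z * r \<nu> else z)"
  define b where "b = (\<lambda>\<nu>. if \<nu> < n then - z else 0)"
  define e where "e = (\<lambda>\<nu>. if \<nu> < n then E \<nu> else m - d)"
  have sume: "(\<Sum>\<nu><L. e \<nu>) = m"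
    using sumE dm by (auto simp: L_def e_def)
  have "(\<Prod>\<nu><L. [:a \<nu>, - b \<nu>:] ^ e \<nu>) = (\<Prod>\<nu><n. [:a \<nu>, - b \<nu>:] ^ e \<nu>) * [:z:] ^ (m - d)"
    using dm by (auto simp: L_def a_def b_def e_def)
  also have "(\<Prod>\<nu><n. [:a \<nu>, - b \<nu>:] ^ e \<nu>) = (\<Prod>\<nu><n. [:z:] ^ E \<nu> * [:- r \<nu>, 1:] ^ E \<nu>)"
    by (intro prod.cong) (auto simp: a_def b_def e_def power_mult_distrib[symmetric] mult.commute)
  also have "\<dots> = [:z:] ^ d * (\<Prod>\<nu><n. [:- r \<nu>, 1:] ^ E \<nu>)"
    by (simp add: prod.distrib power_sum[symmetric] sumE)
  also have "\<dots> * [:z:] ^ (m - d) = [:z:] ^ m * (\<Prod>\<nu><n. [:- r \<nu>, 1:] ^ E \<nu>)"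
    using dm by (simp add: mult_ac power_add[symmetric])
  also have "\<dots> = ?p"
    by (subst dec) (simp add: poly_const_pow z)
  finally have prod: "(\<Prod>\<nu><L. [:a \<nu>, - b \<nu>:] ^ e \<nu>) = ?p" .
  have "symbol_factorization m c L a b e"
    unfolding symbol_factorization_def rotation_symbol_Q
  proof (intro conjI allI impI)
    show "homogenize m ?p = (\<Prod>\<nu><L. (cst (a \<nu>) * \<xi> - cst (b \<nu>) * \<tau>) ^ e \<nu>)"
      using homogenize_linear_product[of e L a b] by (simp add: sume prod)
    show "(\<Sum>\<nu><L. e \<nu>) = m" by (rule sume)
    fix \<nu> assume \<nu>: "\<nu> < L"
    show "(a \<nu>, b \<nu>) \<noteq> (0, 0)" using z0 by (auto simp: a_def b_def)
    show "0 < e \<nu>" using \<nu> E by (auto simp: e_def L_def split: if_splits)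
    fix \<mu> assume \<mu>: "\<mu> < L" "\<mu> \<noteq> \<nu>"
    have "r \<mu> \<noteq> r \<nu>" if "\<mu> < n" "\<nu> < n"
      using r that \<mu> by (auto simp: bij_betw_def inj_on_def)
    then show "a \<nu> * b \<mu> \<noteq> a \<mu> * b \<nu>"
      using \<mu> \<nu> z0 by (auto simp: a_def b_def L_def split: if_splits)
  qed
  then show ?thesis by blast
qed

section \<open>Functions annihilated by a product of directional derivatives\<close>

lemma holo2_has_derivative_along_line:
  assumes f: "holo2 U f" and q: "(x + s * h, y + s * k) \<in> U"
  shows "((\<lambda>s. f (x + s * h, y + s * k)) has_field_derivative
    h * dx f (x + s * h, y + s * k) + k * dy f (x + s * h, y + s * k)) (at s)"
proof -
  let ?q = "(x + s * h, y + s * k)"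
  obtain \<alpha> \<beta> where d: "(f has_derivative (\<lambda>(h, k). \<alpha> * h + \<beta> * k)) (at ?q)"
    using f q unfolding holo2_def by blast
  have "((\<lambda>t. (t, y + s * k)) has_derivative (\<lambda>h. (h, 0))) (at (x + s * h))"
    "((\<lambda>t. (x + s * h, t)) has_derivative (\<lambda>k. (0, k))) (at (y + s * k))"
    by (auto intro!: derivative_eq_intros)
  from has_derivative_compose[OF this(1) d] has_derivative_compose[OF this(2) d]
  have "dx f ?q = \<alpha>" "dy f ?q = \<beta>"
    by (auto intro!: dx_eqI dy_eqI simp: has_field_derivative_def)
  moreover have "((\<lambda>s. (x + s * h, y + s * k)) has_derivative (\<lambda>t. (t * h, t * k))) (at s)"
    by (auto intro!: derivative_eq_intros)
  from has_derivative_compose[OF this d]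
  have "((\<lambda>s. f (x + s * h, y + s * k)) has_field_derivative h * \<alpha> + k * \<beta>) (at s)"
    by (auto simp: has_field_derivative_def algebra_simps elim!: has_derivative_eq_rhs)
  ultimately show ?thesis by simp
qed

definition lin :: "complex \<Rightarrow> complex \<Rightarrow> complex \<times> complex \<Rightarrow> complex" where
  "lin a b = (\<lambda>(x, y). a * x - b * y)"

text \<open>The derivative in the direction \<open>(b, a)\<close>, along which \<open>lin a b\<close> is constant.\<close>

definition Dlin :: "complex \<Rightarrow> complex \<Rightarrow> (complex \<times> complex \<Rightarrow> complex) \<Rightarrow> complex \<times> complex \<Rightarrow> complex" where
  "Dlin a b f = (\<lambda>p. b * dx f p + a * dy f p)"

lemma holo2_Dlin: "open U \<Longrightarrow> holo2 U f \<Longrightarrow> holo2 U (Dlin a b f)"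
  unfolding Dlin_def by (intro holo2_add holo2_cmult holo2_dx holo2_dy)

lemma holo2_lin: "holo2 U (lin a b)"
  using holo2_linear[of U a "- b"] by (simp add: lin_def)

lemma Dlin_add: "holo2 U f \<Longrightarrow> holo2 U g \<Longrightarrow> p \<in> U \<Longrightarrow> Dlin a b (\<lambda>p. f p + g p) p = Dlin a b f p + Dlin a b g p"
  unfolding Dlin_def by (simp add: dx_add[of U] dy_add[of U] algebra_simps)

lemma Dlin_cmult: "holo2 U f \<Longrightarrow> p \<in> U \<Longrightarrow> Dlin a b (\<lambda>p. c * f p) p = c * Dlin a b f p"
  unfolding Dlin_def by (simp only: dx_cmult[of U] dy_cmult[of U]) (simp add: algebra_simps)

lemma Dlin_0 [simp]: "Dlin a b (\<lambda>_. 0) p = 0"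
  using Dlin_cmult[of UNIV "\<lambda>_. 0" p a b 0] by simp

lemma Dlin_sum:
  assumes "\<And>k. k \<in> I \<Longrightarrow> holo2 U (f k)" "p \<in> U"
  shows "Dlin a b (\<lambda>p. \<Sum>k\<in>I. f k p) p = (\<Sum>k\<in>I. Dlin a b (f k) p)"
  using assms by (induction I rule: infinite_finite_induct) (auto simp: Dlin_add[of U] holo2_sum)

text \<open>Moving in a direction of slope \<open>1\<close> for \<open>lin a b\<close> gives local holomorphic sections of \<open>lin a b\<close>; with them the image of an open set is
  seen to be open and functions on the image are seen to be holomorphic.\<close>

lemma lin_section:
  assumes "(a, b) \<noteq> (0, 0)" obtains h k where "lin a b (h, k) = 1"
proof (cases "a = 0")
  case True
  then show ?thesis using assms that[of 0 "- 1 / b"] by (simp add: lin_def)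
next
  case False
  then show ?thesis using that[of "1 / a" 0] by (simp add: lin_def)
qed

lemma lin_line: "lin a b (x + s * h, y + s * k) = lin a b (x, y) + s * lin a b (h, k)"
  by (simp add: lin_def algebra_simps)

lemma open_preimage_line:
  assumes "open (U :: (complex \<times> complex) set)" shows "open {s. (x + s * h, y + s * k) \<in> U}"
  using open_vimage[OF assms, of "\<lambda>s. (x + s * h, y + s * k)"]
  by (simp add: vimage_def continuous_intros)

lemma open_lin_image:
  assumes "open U" "(a, b) \<noteq> (0, 0)" shows "open (lin a b ` U)"
proof -
  obtain h k where hk: "lin a b (h, k) = 1" using lin_section[OF assms(2)] .
  show ?thesis
    unfolding open_subopen[of "lin a b ` U"]
  proof safe
    fix x y assume p: "(x, y) \<in> U"
    let ?T = "(\<lambda>z. z - lin a b (x, y)) -` {s. (x + s * h, y + s * k) \<in> U}"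
    have "open ?T" by (intro open_vimage open_preimage_line assms continuous_intros)
    moreover have "lin a b (x, y) \<in> ?T" using p by simp
    moreover have "?T \<subseteq> lin a b ` U"
    proof
      fix z assume "z \<in> ?T"
      then have "(x + (z - lin a b (x, y)) * h, y + (z - lin a b (x, y)) * k) \<in> U" by simp
      then show "z \<in> lin a b ` U" by (rule rev_image_eqI) (simp add: lin_line hk)
    qed
    ultimately show "\<exists>T. open T \<and> lin a b (x, y) \<in> T \<and> T \<subseteq> lin a b ` U" by blast
  qed
qed

lemma convex_lin_image: "convex U \<Longrightarrow> convex (lin a b ` U)"
  by (rule convex_linear_image[rotated])
    (auto simp: linear_iff lin_def case_prod_unfold algebra_simps scaleR_conv_of_real)

text \<open>Two points of \<open>U\<close> with the same value of \<open>lin a b\<close> differ by a multiple of \<open>(b, a)\<close>.  The complex line through them meets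
  the convex set \<open>U\<close> in a convex set, on which \<open>f\<close> has derivative zero; so \<open>f\<close> has the same value at
  both.  Convexity is essential here: it makes the fibres of \<open>lin a b\<close> in \<open>U\<close> connected.\<close>

lemma function_of_lin:
  assumes U: "open U" "convex U" and f: "holo2 U f" and ab: "(a, b) \<noteq> (0, 0)"
    and D: "\<And>p. p \<in> U \<Longrightarrow> Dlin a b f p = 0"
  obtains F where "F holomorphic_on lin a b ` U" "\<And>p. p \<in> U \<Longrightarrow> f p = F (lin a b p)"
proof -
  have const: "f q = f p" if pq: "p \<in> U" "q \<in> U" "lin a b p = lin a b q" for p q
  proof -
    obtain x y x' y' where p: "p = (x, y)" "q = (x', y')" by (cases p, cases q)
    define t where "t = (if b = 0 then (y' - y) / a else (x' - x) / b)"
    have q: "x' = x + 1 * (t * b)" "y' = y + 1 * (t * a)"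
      using pq(3) ab by (auto simp: p t_def lin_def field_simps split: if_splits)
    let ?S = "{s. (x + s * (t * b), y + s * (t * a)) \<in> U}"
    have "\<exists>c. \<forall>s\<in>?S. f (x + s * (t * b), y + s * (t * a)) = c"
    proof (rule has_field_derivative_zero_constant)
      show "convex ?S"
      proof (rule convexI, clarify)
        fix u v :: complex and r s :: real
        assume u: "(x + u * (t * b), y + u * (t * a)) \<in> U" and v: "(x + v * (t * b), y + v * (t * a)) \<in> U"
          and rs: "0 \<le> r" "0 \<le> s" "r + s = 1"
        have s: "s = 1 - r" using rs by simp
        have "r *\<^sub>R (x + u * (t * b), y + u * (t * a)) + s *\<^sub>R (x + v * (t * b), y + v * (t * a)) \<in> U"
          using convexD[OF U(2) u v] rs by simp
        then show "(x + (r *\<^sub>R u + s *\<^sub>R v) * (t * b), y + (r *\<^sub>R u + s *\<^sub>R v) * (t * a)) \<in> U"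
          by (simp add: s scaleR_conv_of_real algebra_simps)
      qed
      show "((\<lambda>s. f (x + s * (t * b), y + s * (t * a))) has_field_derivative 0) (at s within ?S)"
        if "s \<in> ?S" for s
      proof (rule has_field_derivative_at_within)
        have "t * b * dx f (x + s * (t * b), y + s * (t * a)) + t * a * dy f (x + s * (t * b), y + s * (t * a)) = 0"
          using D[of "(x + s * (t * b), y + s * (t * a))"] that unfolding Dlin_def
          by (simp add: mult.assoc distrib_left[symmetric])
        then show "((\<lambda>s. f (x + s * (t * b), y + s * (t * a))) has_field_derivative 0) (at s)"
          using holo2_has_derivative_along_line[OF f, of x s "t * b" y "t * a"] that by simp
      qed
    qed
    then obtain c where "\<And>s. s \<in> ?S \<Longrightarrow> f (x + s * (t * b), y + s * (t * a)) = c" by blast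
    from this[of 0] this[of 1] show ?thesis using pq p q by simp
  qed
  define F where "F = (\<lambda>z. f (SOME p. p \<in> U \<and> lin a b p = z))"
  have F: "F (lin a b p) = f p" if "p \<in> U" for p
  proof -
    have "\<exists>q. q \<in> U \<and> lin a b q = lin a b p" using that by blast
    from someI_ex[OF this] show ?thesis unfolding F_def using const[of p] that by metis
  qed
  obtain h k where hk: "lin a b (h, k) = 1" using lin_section[OF ab] .
  have "F field_differentiable at (lin a b p)" if "p \<in> U" for p
  proof -
    obtain x y where p: "p = (x, y)" by (cases p)
    let ?w = "lin a b (x, y)"
    let ?g = "\<lambda>s. f (x + s * h, y + s * k)"
    obtain d where d: "(?g has_field_derivative d) (at (?w - ?w))"
      using holo2_has_derivative_along_line[OF f, of x "?w - ?w" h y k] \<open>p \<in> U\<close> unfolding p by auto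
    have "((\<lambda>z. z - ?w) has_field_derivative 1) (at ?w)" by (auto intro!: derivative_eq_intros)
    from DERIV_chain2[OF d this] have gd: "((\<lambda>z. ?g (z - ?w)) has_field_derivative d) (at ?w)" by simp
    have "(F has_field_derivative d) (at ?w)"
    proof (rule has_field_derivative_transform_within_open[OF gd])
      show "open ((\<lambda>z. z - ?w) -` {s. (x + s * h, y + s * k) \<in> U})"
        by (intro open_vimage open_preimage_line U continuous_intros)
      show "?w \<in> (\<lambda>z. z - ?w) -` {s. (x + s * h, y + s * k) \<in> U}" using that p by simp
      fix z assume "z \<in> (\<lambda>z. z - ?w) -` {s. (x + s * h, y + s * k) \<in> U}"
      then show "?g (z - ?w) = F z"
        using F[of "(x + (z - ?w) * h, y + (z - ?w) * k)"] by (simp add: lin_line hk)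
    qed
    then show ?thesis by (auto simp: p field_differentiable_def)
  qed
  then have "F holomorphic_on lin a b ` U"
    unfolding holomorphic_on_def by (metis field_differentiable_at_within imageE)
  then show thesis using that F by metis
qed

text \<open>The building blocks of the solution are powers of a linear form \<open>\<alpha> x + \<beta> y\<close> times functions of
  \<open>lin a b\<close>.\<close>

lemma Dlin_monomial:
  assumes "(F has_field_derivative d) (at (lin a b (x, y)))" 
  shows "Dlin a' b' (\<lambda>(x, y). (\<alpha> * x + \<beta> * y) ^ i * F (lin a b (x, y))) (x, y) =
    of_nat i * (b' * \<alpha> + a' * \<beta>) * (\<alpha> * x + \<beta> * y) ^ (i - 1) * F (lin a b (x, y))
    + (b' * a - a' * b) * (\<alpha> * x + \<beta> * y) ^ i * d"
proof -
  have F': "(F has_field_derivative d) (at (a * x - b * y))" using assms by (simp add: lin_def)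
  have "((\<lambda>x. a * x - b * y) has_field_derivative a) (at x)" "((\<lambda>y. a * x - b * y) has_field_derivative - b) (at y)"
    by (auto intro!: derivative_eq_intros)
  from DERIV_chain2[where f=F, OF F' this(1)] DERIV_chain2[where f=F, OF F' this(2)]
  have Fx: "((\<lambda>x. F (a * x - b * y)) has_field_derivative d * a) (at x)"
    and Fy: "((\<lambda>y. F (a * x - b * y)) has_field_derivative d * - b) (at y)" .
  have px: "((\<lambda>x. (\<alpha> * x + \<beta> * y) ^ i) has_field_derivative of_nat i * \<alpha> * (\<alpha> * x + \<beta> * y) ^ (i - 1)) (at x)"
    and py: "((\<lambda>y. (\<alpha> * x + \<beta> * y) ^ i) has_field_derivative of_nat i * \<beta> * (\<alpha> * x + \<beta> * y) ^ (i - 1)) (at y)"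
    by (auto intro!: derivative_eq_intros)
  have "dx (\<lambda>(x, y). (\<alpha> * x + \<beta> * y) ^ i * F (lin a b (x, y))) (x, y) =
      (of_nat i * \<alpha> * (\<alpha> * x + \<beta> * y) ^ (i - 1)) * F (a * x - b * y) + (d * a) * (\<alpha> * x + \<beta> * y) ^ i"
    using DERIV_mult[OF px Fx] by (intro dx_eqI) (simp add: lin_def)
  moreover have "dy (\<lambda>(x, y). (\<alpha> * x + \<beta> * y) ^ i * F (lin a b (x, y))) (x, y) =
      (of_nat i * \<beta> * (\<alpha> * x + \<beta> * y) ^ (i - 1)) * F (a * x - b * y) + (d * - b) * (\<alpha> * x + \<beta> * y) ^ i"
    using DERIV_mult[OF py Fy] by (intro dy_eqI) (simp add: lin_def)
  ultimately show ?thesis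
    by (simp only: Dlin_def) (simp add: lin_def algebra_simps)
qed

lemma holo2_monomial:
  assumes U: "open U" "(a, b) \<noteq> (0, 0)" and F: "F holomorphic_on lin a b ` U"
  shows "holo2 U (\<lambda>(x, y). (\<alpha> * x + \<beta> * y) ^ i * F (lin a b (x, y)))"
proof -
  have "holo2 U (\<lambda>p. (case p of (x, y) \<Rightarrow> \<alpha> * x + \<beta> * y) ^ i * F (lin a b p))"
  proof (rule holo2_mult)
    show "holo2 U (\<lambda>p. (case p of (x, y) \<Rightarrow> \<alpha> * x + \<beta> * y) ^ i)"
      by (rule holo2_power) (rule holo2_linear)
    show "holo2 U (\<lambda>p. F (lin a b p))"
      by (rule holo2_compose[OF _ holo2_lin])
        (use F open_lin_image[OF U] holomorphic_on_imp_differentiable_at in blast)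
  qed
  then show ?thesis by (simp add: case_prod_unfold)
qed

text \<open>Along a direction that is transversal to the fibres of \<open>lin a b\<close>, the function \<open>T\<^sup>i F\<close> is integrated by
  parts: with \<open>G\<close> a multiple of a primitive of \<open>F\<close>, the derivative of \<open>T\<^sup>i G\<close> is \<open>T\<^sup>i F\<close> plus a multiple
  of \<open>T\<^sup>i\<^sup>-\<^sup>1 G\<close>, and induction on \<open>i\<close> corrects the error without raising the power of \<open>T\<close>.  The primitive exists
  because the image of \<open>U\<close> is open and convex.\<close>

lemma antiderivative_transversal:
  assumes U: "open U" "convex U" and ab: "(a, b) \<noteq> (0, 0)"
    and \<kappa>: "b' * a - a' * b \<noteq> 0"
    and F: "F holomorphic_on lin a b ` U"
  shows "\<exists>H. (\<forall>j\<le>i. H j holomorphic_on lin a b ` U) \<and>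
    (\<forall>(x, y)\<in>U. (\<Sum>j\<le>i. Dlin a' b' (\<lambda>(x, y). (\<alpha> * x + \<beta> * y) ^ j * H j (lin a b (x, y))) (x, y)) =
      (\<alpha> * x + \<beta> * y) ^ i * F (lin a b (x, y)))"
  using F
proof (induction i arbitrary: F)
  let ?W = "lin a b ` U"
  have oW: "open ?W" "convex ?W" by (simp_all add: open_lin_image[OF U(1) ab] convex_lin_image[OF U(2)])
  let ?k = "b' * a - a' * b"
  have prim: "\<exists>G. G holomorphic_on ?W \<and> (\<forall>z\<in>?W. (G has_field_derivative F z / ?k) (at z))"
    if F: "F holomorphic_on ?W" for F
  proof -
    have "(\<lambda>z. F z / ?k) holomorphic_on ?W" by (intro holomorphic_intros F \<kappa>)
    then obtain G where G: "\<And>x. x \<in> ?W \<Longrightarrow> (G has_field_derivative F x / ?k) (at x within ?W)"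
      using holomorphic_convex_primitive' oW by blast
    then have "\<forall>z\<in>?W. (G has_field_derivative F z / ?k) (at z)" using at_within_open[OF _ oW(1)] by metis
    then show ?thesis using G by (metis field_differentiable_def holomorphic_on_def)
  qed
  {
    case 0
    from prim[OF this] obtain G where G: "G holomorphic_on ?W"
      "\<And>z. z\<in>?W \<Longrightarrow> (G has_field_derivative F z / ?k) (at z)" by blast
    have "Dlin a' b' (\<lambda>p. G (lin a b p)) (x, y) = F (lin a b (x, y))"
      if "(x, y) \<in> U" for x y
      using Dlin_monomial[OF G(2), where x=x and y=y and a=a and b=b and a'=a' and b'=b' and \<alpha>=\<alpha> and \<beta>=\<beta> and i=0] that \<kappa>
      by (simp add: case_prod_unfold)
    then show ?case using G(1) by (intro exI[of _ "\<lambda>_. G"]) (auto simp: case_prod_unfold)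
  next
    case (Suc i)
    from prim[OF Suc.prems] obtain G where G: "G holomorphic_on ?W"
      "\<And>z. z\<in>?W \<Longrightarrow> (G has_field_derivative F z / ?k) (at z)" by blast
    let ?F = "\<lambda>z. - (of_nat (Suc i) * (b' * \<alpha> + a' * \<beta>)) * G z"
    have "?F holomorphic_on ?W" by (intro holomorphic_intros G)
    from Suc.IH[OF this] obtain H where H: "\<And>j. j \<le> i \<Longrightarrow> H j holomorphic_on ?W"
      "\<And>x y. (x, y) \<in> U \<Longrightarrow> (\<Sum>j\<le>i. Dlin a' b' (\<lambda>(x, y). (\<alpha> * x + \<beta> * y) ^ j * H j (lin a b (x, y))) (x, y)) =
        (\<alpha> * x + \<beta> * y) ^ i * ?F (lin a b (x, y))" by blast
    define H' where "H' = H(Suc i := G)"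
    have "(\<Sum>j\<le>Suc i. Dlin a' b' (\<lambda>(x, y). (\<alpha> * x + \<beta> * y) ^ j * H' j (lin a b (x, y))) (x, y)) =
      (\<alpha> * x + \<beta> * y) ^ Suc i * F (lin a b (x, y))" if xy: "(x, y) \<in> U" for x y
    proof -
      have "(\<Sum>j\<le>Suc i. Dlin a' b' (\<lambda>(x, y). (\<alpha> * x + \<beta> * y) ^ j * H' j (lin a b (x, y))) (x, y)) =
        (\<Sum>j\<le>i. Dlin a' b' (\<lambda>(x, y). (\<alpha> * x + \<beta> * y) ^ j * H j (lin a b (x, y))) (x, y)) +
        Dlin a' b' (\<lambda>(x, y). (\<alpha> * x + \<beta> * y) ^ Suc i * G (lin a b (x, y))) (x, y)"
        by (simp add: H'_def)
      also have "Dlin a' b' (\<lambda>(x, y). (\<alpha> * x + \<beta> * y) ^ Suc i * G (lin a b (x, y))) (x, y) =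
        of_nat (Suc i) * (b' * \<alpha> + a' * \<beta>) * (\<alpha> * x + \<beta> * y) ^ i * G (lin a b (x, y))
        + (\<alpha> * x + \<beta> * y) ^ Suc i * F (lin a b (x, y))"
        using Dlin_monomial[OF G(2), where x=x and y=y and a=a and b=b and a'=a' and b'=b' and \<alpha>=\<alpha> and \<beta>=\<beta> and i="Suc i"] xy \<kappa> by simp
      finally show ?thesis unfolding H(2)[OF xy] by (simp add: algebra_simps)
    qed
    moreover have "\<forall>j\<le>Suc i. H' j holomorphic_on ?W" using H(1) G(1) by (auto simp: H'_def le_Suc_eq)
    ultimately show ?case by (intro exI[of _ H']) auto
  }
qed

text \<open>The shape asserted for the entries of \<open>R\<close>, with arbitrary linear forms \<open>\<alpha> x + \<beta> y\<close> in place of the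
  transverse ones.  Exponents \<open>e \<nu> = 0\<close> are allowed, since the induction lowers the exponents one at a time.\<close>

definition superposition ::
  "(complex \<times> complex) set \<Rightarrow> nat \<Rightarrow> (nat \<Rightarrow> complex) \<Rightarrow> (nat \<Rightarrow> complex) \<Rightarrow> (nat \<Rightarrow> complex) \<Rightarrow>
   (nat \<Rightarrow> complex) \<Rightarrow> (nat \<Rightarrow> nat) \<Rightarrow> (complex \<times> complex \<Rightarrow> complex) \<Rightarrow> bool" where
  "superposition U L a b \<alpha> \<beta> e f \<longleftrightarrow> (\<exists>F.
     (\<forall>\<nu><L. \<forall>i<e \<nu>. F \<nu> i holomorphic_on lin (a \<nu>) (b \<nu>) ` U) \<and>
     (\<forall>(x, y)\<in>U. f (x, y) = (\<Sum>\<nu><L. \<Sum>i<e \<nu>. (\<alpha> \<nu> * x + \<beta> \<nu> * y) ^ i * F \<nu> i (lin (a \<nu>) (b \<nu>) (x, y)))))"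

lemma superposition_add:
  assumes "superposition U L a b \<alpha> \<beta> e f" "superposition U L a b \<alpha> \<beta> e g"
  shows "superposition U L a b \<alpha> \<beta> e (\<lambda>p. f p + g p)"
proof -
  obtain F where F: "\<And>\<nu> i. \<nu> < L \<Longrightarrow> i < e \<nu> \<Longrightarrow> F \<nu> i holomorphic_on lin (a \<nu>) (b \<nu>) ` U"
    "\<And>x y. (x, y)\<in>U \<Longrightarrow> f (x, y) = (\<Sum>\<nu><L. \<Sum>i<e \<nu>. (\<alpha> \<nu> * x + \<beta> \<nu> * y) ^ i * F \<nu> i (lin (a \<nu>) (b \<nu>) (x, y)))"
    using assms(1) unfolding superposition_def by blast
  obtain G where G: "\<And>\<nu> i. \<nu> < L \<Longrightarrow> i < e \<nu> \<Longrightarrow> G \<nu> i holomorphic_on lin (a \<nu>) (b \<nu>) ` U"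
    "\<And>x y. (x, y)\<in>U \<Longrightarrow> g (x, y) = (\<Sum>\<nu><L. \<Sum>i<e \<nu>. (\<alpha> \<nu> * x + \<beta> \<nu> * y) ^ i * G \<nu> i (lin (a \<nu>) (b \<nu>) (x, y)))"
    using assms(2) unfolding superposition_def by blast
  show ?thesis unfolding superposition_def
    by (rule exI[of _ "\<lambda>\<nu> i z. F \<nu> i z + G \<nu> i z"])
      (auto intro!: holomorphic_intros F(1) G(1) simp: F(2) G(2) sum.distrib distrib_left)
qed

lemma superposition_0: "superposition U L a b \<alpha> \<beta> e (\<lambda>_. 0)"
  unfolding superposition_def by (rule exI[of _ "\<lambda>_ _ _. 0"]) auto

lemma superposition_sum: "(\<And>k. k \<in> I \<Longrightarrow> superposition U L a b \<alpha> \<beta> e (f k)) \<Longrightarrow> superposition U L a b \<alpha> \<beta> e (\<lambda>p. \<Sum>k\<in>I. f k p)"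
  by (induction I rule: infinite_finite_induct) (auto intro: superposition_add superposition_0)

lemma superposition_cong: "(\<And>p. p \<in> U \<Longrightarrow> f p = g p) \<Longrightarrow> superposition U L a b \<alpha> \<beta> e g \<Longrightarrow> superposition U L a b \<alpha> \<beta> e f"
  unfolding superposition_def by (metis (no_types, lifting) case_prodD case_prodI2)

lemma superposition_term:
  assumes "\<nu>0 < L" "i0 < e \<nu>0" "F holomorphic_on lin (a \<nu>0) (b \<nu>0) ` U"
  shows "superposition U L a b \<alpha> \<beta> e (\<lambda>(x, y). (\<alpha> \<nu>0 * x + \<beta> \<nu>0 * y) ^ i0 * F (lin (a \<nu>0) (b \<nu>0) (x, y)))"
  unfolding superposition_def
proof (intro exI conjI allI impI ballI)
  let ?G = "\<lambda>\<nu> i z. if \<nu> = \<nu>0 \<and> i = i0 then F z else 0"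
  show "?G \<nu> i holomorphic_on lin (a \<nu>) (b \<nu>) ` U" for \<nu> i
    using assms(3) by (cases "\<nu> = \<nu>0 \<and> i = i0") auto
  fix p assume "p \<in> U"
  have "(\<Sum>\<nu><L. \<Sum>i<e \<nu>. (\<alpha> \<nu> * x + \<beta> \<nu> * y) ^ i * ?G \<nu> i (lin (a \<nu>) (b \<nu>) (x, y))) =
    (\<alpha> \<nu>0 * x + \<beta> \<nu>0 * y) ^ i0 * F (lin (a \<nu>0) (b \<nu>0) (x, y))" for x y
  proof -
    have "(\<Sum>i<e \<nu>. (\<alpha> \<nu> * x + \<beta> \<nu> * y) ^ i * ?G \<nu> i (lin (a \<nu>) (b \<nu>) (x, y))) =
      (if \<nu> = \<nu>0 then (\<alpha> \<nu>0 * x + \<beta> \<nu>0 * y) ^ i0 * F (lin (a \<nu>0) (b \<nu>0) (x, y)) else 0)" for \<nu>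
      using assms(2) by (cases "\<nu> = \<nu>0") (simp_all add: if_distrib sum.delta cong: if_cong)
    then show ?thesis using assms(1) by (simp add: sum.delta)
  qed
  then show "case p of (x, y) \<Rightarrow> (case (x, y) of (x, y) \<Rightarrow> (\<alpha> \<nu>0 * x + \<beta> \<nu>0 * y) ^ i0 * F (lin (a \<nu>0) (b \<nu>0) (x, y))) =
    (\<Sum>\<nu><L. \<Sum>i<e \<nu>. (\<alpha> \<nu> * x + \<beta> \<nu> * y) ^ i * ?G \<nu> i (lin (a \<nu>) (b \<nu>) (x, y)))"
    by (cases p) simp
qed

text \<open>For \<open>\<nu> \<noteq> \<mu>\<close> the term is integrated transversally and no exponent grows.  For \<open>\<nu> = \<mu>\<close> the function of
  \<open>lin (a \<mu>) (b \<mu>)\<close> is a constant for the derivative, and the term is integrated like a power of a single variable; this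
  uses that the linear form is not constant along the direction, and raises the exponent \<open>e \<mu>\<close> by one.\<close>

lemma superposition_antiderivative_term:
  assumes U: "open U" "convex U"
    and ab: "\<And>\<nu>. \<nu> < L \<Longrightarrow> (a \<nu>, b \<nu>) \<noteq> (0, 0)"
    and distinct: "\<And>\<nu> \<mu>. \<nu> < L \<Longrightarrow> \<mu> < L \<Longrightarrow> \<mu> \<noteq> \<nu> \<Longrightarrow> a \<nu> * b \<mu> \<noteq> a \<mu> * b \<nu>"
    and transv: "\<And>\<nu>. \<nu> < L \<Longrightarrow> b \<nu> * \<alpha> \<nu> + a \<nu> * \<beta> \<nu> \<noteq> 0"
    and \<mu>: "\<mu> < L" and \<nu>: "\<nu> < L" and i: "i < e \<nu>" and F: "F holomorphic_on lin (a \<nu>) (b \<nu>) ` U"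
  shows "\<exists>h. holo2 U h \<and> superposition U L a b \<alpha> \<beta> (e(\<mu> := Suc (e \<mu>))) h \<and>
    (\<forall>(x, y)\<in>U. Dlin (a \<mu>) (b \<mu>) h (x, y) = (\<alpha> \<nu> * x + \<beta> \<nu> * y) ^ i * F (lin (a \<nu>) (b \<nu>) (x, y)))"
proof (cases "\<nu> = \<mu>")
  case True
  define c where "c = of_nat (Suc i) * (b \<mu> * \<alpha> \<mu> + a \<mu> * \<beta> \<mu>)"
  have c: "c \<noteq> 0" using transv[OF \<mu>] by (simp add: c_def del: of_nat_Suc)
  have Fc: "(\<lambda>z. F z / c) holomorphic_on lin (a \<mu>) (b \<mu>) ` U"
    using F c True by (intro holomorphic_intros) auto
  let ?h = "\<lambda>(x, y). (\<alpha> \<mu> * x + \<beta> \<mu> * y) ^ Suc i * (F (lin (a \<mu>) (b \<mu>) (x, y)) / c)"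
  have "Dlin (a \<mu>) (b \<mu>) ?h (x, y) = (\<alpha> \<nu> * x + \<beta> \<nu> * y) ^ i * F (lin (a \<nu>) (b \<nu>) (x, y))"
    if xy: "(x, y) \<in> U" for x y
  proof -
    have "(\<lambda>z. F z / c) field_differentiable at (lin (a \<mu>) (b \<mu>) (x, y))"
      using Fc open_lin_image[OF U(1) ab[OF \<mu>]] xy holomorphic_on_imp_differentiable_at by blast
    then obtain d where "((\<lambda>z. F z / c) has_field_derivative d) (at (lin (a \<mu>) (b \<mu>) (x, y)))"
      by (auto simp: field_differentiable_def)
    from Dlin_monomial[OF this, where a'="a \<mu>" and b'="b \<mu>" and \<alpha>="\<alpha> \<mu>" and \<beta>="\<beta> \<mu>" and i="Suc i"]
    have "Dlin (a \<mu>) (b \<mu>) ?h (x, y) = c * (\<alpha> \<mu> * x + \<beta> \<mu> * y) ^ i * (F (lin (a \<mu>) (b \<mu>) (x, y)) / c)"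
      by (simp add: c_def algebra_simps)
    then show ?thesis using c True by simp
  qed
  moreover have "holo2 U ?h"
    by (rule holo2_monomial[OF U(1) ab[OF \<mu>] Fc])
  moreover have "superposition U L a b \<alpha> \<beta> (e(\<mu> := Suc (e \<mu>))) ?h"
    using i True \<mu> Fc by (intro superposition_term) auto
  ultimately show ?thesis by (intro exI[of _ ?h]) auto
next
  case False
  let ?m = "\<lambda>H j (x, y). (\<alpha> \<nu> * x + \<beta> \<nu> * y) ^ j * H j (lin (a \<nu>) (b \<nu>) (x, y))"
  have "b \<mu> * a \<nu> - a \<mu> * b \<nu> \<noteq> 0" using distinct[OF \<nu> \<mu>] False by (simp add: mult.commute)
  from antiderivative_transversal[OF U ab[OF \<nu>] this F, of i "\<alpha> \<nu>" "\<beta> \<nu>"] obtain H where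
    H: "\<And>j. j \<le> i \<Longrightarrow> H j holomorphic_on lin (a \<nu>) (b \<nu>) ` U"
    "\<And>x y. (x, y)\<in>U \<Longrightarrow> (\<Sum>j\<le>i. Dlin (a \<mu>) (b \<mu>) (?m H j) (x, y)) =
      (\<alpha> \<nu> * x + \<beta> \<nu> * y) ^ i * F (lin (a \<nu>) (b \<nu>) (x, y))" by blast
  let ?h = "\<lambda>p. \<Sum>j\<le>i. ?m H j p"
  have hol: "holo2 U (?m H j)" if "j \<in> {..i}" for j
    using holo2_monomial[OF U(1) ab[OF \<nu>] H(1)] that by simp
  have "superposition U L a b \<alpha> \<beta> (e(\<mu> := Suc (e \<mu>))) ?h"
    using i False H(1) by (intro superposition_sum superposition_term \<nu>) auto
  moreover have "holo2 U ?h" by (rule holo2_sum[OF hol])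
  moreover have "\<forall>(x, y)\<in>U. Dlin (a \<mu>) (b \<mu>) ?h (x, y) = (\<alpha> \<nu> * x + \<beta> \<nu> * y) ^ i * F (lin (a \<nu>) (b \<nu>) (x, y))"
    using H(2) Dlin_sum[OF hol, of "{..i}"] by auto
  ultimately show ?thesis by blast
qed

lemma superposition_antiderivative:
  assumes U: "open U" "convex U"
    and ab: "\<And>\<nu>. \<nu> < L \<Longrightarrow> (a \<nu>, b \<nu>) \<noteq> (0, 0)"
    and distinct: "\<And>\<nu> \<mu>. \<nu> < L \<Longrightarrow> \<mu> < L \<Longrightarrow> \<mu> \<noteq> \<nu> \<Longrightarrow> a \<nu> * b \<mu> \<noteq> a \<mu> * b \<nu>"
    and transv: "\<And>\<nu>. \<nu> < L \<Longrightarrow> b \<nu> * \<alpha> \<nu> + a \<nu> * \<beta> \<nu> \<noteq> 0"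
    and \<mu>: "\<mu> < L" and g: "superposition U L a b \<alpha> \<beta> e g"
  obtains h where "holo2 U h" "superposition U L a b \<alpha> \<beta> (e(\<mu> := Suc (e \<mu>))) h"
    "\<And>p. p \<in> U \<Longrightarrow> Dlin (a \<mu>) (b \<mu>) h p = g p"
proof -
  obtain F where F: "\<And>\<nu> i. \<nu> < L \<Longrightarrow> i < e \<nu> \<Longrightarrow> F \<nu> i holomorphic_on lin (a \<nu>) (b \<nu>) ` U"
    "\<And>x y. (x, y)\<in>U \<Longrightarrow> g (x, y) = (\<Sum>\<nu><L. \<Sum>i<e \<nu>. (\<alpha> \<nu> * x + \<beta> \<nu> * y) ^ i * F \<nu> i (lin (a \<nu>) (b \<nu>) (x, y)))"
    using g unfolding superposition_def by blast
  have "\<forall>\<nu> i. \<exists>h. \<nu> < L \<longrightarrow> i < e \<nu> \<longrightarrow> holo2 U h \<and> superposition U L a b \<alpha> \<beta> (e(\<mu> := Suc (e \<mu>))) h \<and>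
    (\<forall>(x, y)\<in>U. Dlin (a \<mu>) (b \<mu>) h (x, y) = (\<alpha> \<nu> * x + \<beta> \<nu> * y) ^ i * F \<nu> i (lin (a \<nu>) (b \<nu>) (x, y)))"
  proof (intro allI)
    fix \<nu> i
    show "\<exists>h. \<nu> < L \<longrightarrow> i < e \<nu> \<longrightarrow> holo2 U h \<and> superposition U L a b \<alpha> \<beta> (e(\<mu> := Suc (e \<mu>))) h \<and>
      (\<forall>(x, y)\<in>U. Dlin (a \<mu>) (b \<mu>) h (x, y) = (\<alpha> \<nu> * x + \<beta> \<nu> * y) ^ i * F \<nu> i (lin (a \<nu>) (b \<nu>) (x, y)))"
    proof (cases "\<nu> < L \<and> i < e \<nu>")
      case True
      then have "\<exists>h. holo2 U h \<and> superposition U L a b \<alpha> \<beta> (e(\<mu> := Suc (e \<mu>))) h \<and>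
        (\<forall>(x, y)\<in>U. Dlin (a \<mu>) (b \<mu>) h (x, y) = (\<alpha> \<nu> * x + \<beta> \<nu> * y) ^ i * F \<nu> i (lin (a \<nu>) (b \<nu>) (x, y)))"
        by (intro superposition_antiderivative_term[where a=a and b=b and \<alpha>=\<alpha> and \<beta>=\<beta> and F="F \<nu> i"])
          (use U ab distinct transv \<mu> F(1) in auto)
      then show ?thesis by blast
    qed auto
  qed
  then obtain h where h': "\<forall>\<nu> i. \<nu> < L \<longrightarrow> i < e \<nu> \<longrightarrow> holo2 U (h \<nu> i) \<and>
    superposition U L a b \<alpha> \<beta> (e(\<mu> := Suc (e \<mu>))) (h \<nu> i) \<and>
    (\<forall>(x, y)\<in>U. Dlin (a \<mu>) (b \<mu>) (h \<nu> i) (x, y) = (\<alpha> \<nu> * x + \<beta> \<nu> * y) ^ i * F \<nu> i (lin (a \<nu>) (b \<nu>) (x, y)))"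
    unfolding choice_iff by blast
  have h: "\<And>\<nu> i. \<nu> < L \<Longrightarrow> i < e \<nu> \<Longrightarrow> holo2 U (h \<nu> i)"
    "\<And>\<nu> i. \<nu> < L \<Longrightarrow> i < e \<nu> \<Longrightarrow> superposition U L a b \<alpha> \<beta> (e(\<mu> := Suc (e \<mu>))) (h \<nu> i)"
    "\<And>\<nu> i x y. \<nu> < L \<Longrightarrow> i < e \<nu> \<Longrightarrow> (x, y) \<in> U \<Longrightarrow>
      Dlin (a \<mu>) (b \<mu>) (h \<nu> i) (x, y) = (\<alpha> \<nu> * x + \<beta> \<nu> * y) ^ i * F \<nu> i (lin (a \<nu>) (b \<nu>) (x, y))"
    using h' by blast+
  let ?h = "\<lambda>p. \<Sum>\<nu><L. \<Sum>i<e \<nu>. h \<nu> i p"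
  show thesis
  proof
    show "holo2 U ?h" by (intro holo2_sum h(1)) auto
    show "superposition U L a b \<alpha> \<beta> (e(\<mu> := Suc (e \<mu>))) ?h" by (intro superposition_sum h(2)) auto
    fix p assume p: "p \<in> U"
    obtain x y where xy: "p = (x, y)" by (cases p)
    have "Dlin (a \<mu>) (b \<mu>) ?h p = (\<Sum>\<nu><L. Dlin (a \<mu>) (b \<mu>) (\<lambda>p. \<Sum>i<e \<nu>. h \<nu> i p) p)"
      by (rule Dlin_sum[OF _ p]) (auto intro!: holo2_sum h(1))
    also have "\<dots> = (\<Sum>\<nu><L. \<Sum>i<e \<nu>. Dlin (a \<mu>) (b \<mu>) (h \<nu> i) p)"
      by (intro sum.cong refl Dlin_sum[OF _ p]) (auto intro!: h(1))
    also have "\<dots> = g p" using p by (simp add: xy F(2) h(3))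
    finally show "Dlin (a \<mu>) (b \<mu>) ?h p = g p" .
  qed
qed

text \<open>The differential operator obtained from the form \<open>homogenize n p\<close> by the substitution
  \<open>\<xi> \<mapsto> \<partial>\<^sub>y\<close>, \<open>\<tau> \<mapsto> - \<partial>\<^sub>x\<close>.\<close>

definition directional_op :: "nat \<Rightarrow> complex poly \<Rightarrow> (complex \<times> complex \<Rightarrow> complex) \<Rightarrow> complex \<times> complex \<Rightarrow> complex" where
  "directional_op n p f = (\<lambda>z. \<Sum>k\<le>n. coeff p k * (- 1) ^ k * dxy k (n - k) f z)"

text \<open>The linear form \<open>a \<xi> - b \<tau>\<close> is substituted by \<open>Dlin a b\<close>.  The bound on the degree ensures that
  \<open>homogenize n p\<close>, and with it the operator, retains all of \<open>p\<close>.\<close>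

lemma directional_op_linear_factor:
  assumes U: "open U" and f: "holo2 U f" and z: "z \<in> U" and p: "degree p \<le> n"
  shows "directional_op (Suc n) ([:a, - b:] * p) f z = directional_op n p (Dlin a b f) z"
proof -
  let ?d = "\<lambda>k j. dxy k j f z"
  have c0: "coeff p (Suc n) = 0" using p by (simp add: coeff_eq_0)
  have "directional_op (Suc n) ([:a, - b:] * p) f z =
      (\<Sum>k\<le>Suc n. a * coeff p k * (- 1) ^ k * ?d k (Suc n - k)) +
      (\<Sum>k\<le>Suc n. (case k of 0 \<Rightarrow> 0 | Suc j \<Rightarrow> - b * coeff p j) * (- 1) ^ k * ?d k (Suc n - k))"
    unfolding directional_op_def sum.distrib[symmetric]
    by (intro sum.cong refl) (auto simp: algebra_simps coeff_pCons split: nat.splits)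
  also have "(\<Sum>k\<le>Suc n. a * coeff p k * (- 1) ^ k * ?d k (Suc n - k)) =
      (\<Sum>k\<le>n. a * coeff p k * (- 1) ^ k * ?d k (Suc (n - k)))"
    using c0 by (simp add: Suc_diff_le)
  also have "(\<Sum>k\<le>Suc n. (case k of 0 \<Rightarrow> 0 | Suc j \<Rightarrow> - b * coeff p j) * (- 1) ^ k * ?d k (Suc n - k)) =
      (\<Sum>k\<le>n. b * coeff p k * (- 1) ^ k * ?d (Suc k) (n - k))"
    by (subst sum.atMost_Suc_shift) simp
  also have "(\<Sum>k\<le>n. a * coeff p k * (- 1) ^ k * ?d k (Suc (n - k))) +
      (\<Sum>k\<le>n. b * coeff p k * (- 1) ^ k * ?d (Suc k) (n - k)) = directional_op n p (Dlin a b f) z"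
    unfolding directional_op_def sum.distrib[symmetric]
  proof (intro sum.cong refl)
    fix k
    have "dxy k (n - k) (Dlin a b f) z = b * ?d (Suc k) (n - k) + a * ?d k (Suc (n - k))"
      unfolding Dlin_def
      by (simp add: dxy_add[OF U _ _ z] dxy_cmult[OF U _ z] holo2_cmult holo2_dx[OF U f] holo2_dy[OF U f]
          dxy_dx[OF U f z] dxy_dy del: mult_minus_left)
    then show "a * coeff p k * (- 1) ^ k * ?d k (Suc (n - k)) + b * coeff p k * (- 1) ^ k * ?d (Suc k) (n - k) =
      coeff p k * (- 1) ^ k * dxy k (n - k) (Dlin a b f) z"
      by (simp add: algebra_simps)
  qed
  finally show ?thesis .
qed

text \<open>Induction on the number of linear factors.  One factor \<open>\<mu>\<close> is applied to \<open>f\<close> first; the result is a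
  superposition with \<open>e \<mu>\<close> lowered by one, and so has an antiderivative \<open>h\<close> that is a superposition with the exponents \<open>e\<close>.
  The difference \<open>f - h\<close> is a function of \<open>lin (a \<mu>) (b \<mu>)\<close>, which is the term with power \<open>0\<close>.\<close>

lemma superposition_kernel:
  assumes U: "open U" "convex U"
    and ab: "\<And>\<nu>. \<nu> < L \<Longrightarrow> (a \<nu>, b \<nu>) \<noteq> (0, 0)"
    and distinct: "\<And>\<nu> \<mu>. \<nu> < L \<Longrightarrow> \<mu> < L \<Longrightarrow> \<mu> \<noteq> \<nu> \<Longrightarrow> a \<nu> * b \<mu> \<noteq> a \<mu> * b \<nu>"
    and transv: "\<And>\<nu>. \<nu> < L \<Longrightarrow> b \<nu> * \<alpha> \<nu> + a \<nu> * \<beta> \<nu> \<noteq> 0"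
    and f: "holo2 U f" and n: "n = (\<Sum>\<nu><L. e \<nu>)"
    and ker: "\<And>p. p \<in> U \<Longrightarrow> directional_op n (\<Prod>\<nu><L. [:a \<nu>, - b \<nu>:] ^ e \<nu>) f p = 0"
  shows "superposition U L a b \<alpha> \<beta> e f"
  using f n ker
proof (induction n arbitrary: f e)
  case 0
  then have "(\<Prod>\<nu><L. [:a \<nu>, - b \<nu>:] ^ e \<nu>) = 1" by simp
  with 0(3) have "f p = 0" if "p \<in> U" for p using that by (simp add: directional_op_def dxy_def)
  then show ?case using superposition_0 superposition_cong by metis
next
  case (Suc n)
  have "\<exists>\<mu><L. e \<mu> \<noteq> 0"
  proof (rule ccontr)
    assume "\<not> (\<exists>\<mu><L. e \<mu> \<noteq> 0)"
    then show False using Suc.prems(2) by simp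
  qed
  then obtain \<mu> where \<mu>: "\<mu> < L" "e \<mu> \<noteq> 0" by blast
  define e' where "e' = e(\<mu> := e \<mu> - 1)"
  have e: "e = e'(\<mu> := Suc (e' \<mu>))" using \<mu> by (auto simp: e'_def)
  have "(\<Sum>\<nu><L. e \<nu>) = e \<mu> + (\<Sum>\<nu>\<in>{..<L}-{\<mu>}. e \<nu>)" "(\<Sum>\<nu><L. e' \<nu>) = e' \<mu> + (\<Sum>\<nu>\<in>{..<L}-{\<mu>}. e' \<nu>)"
    using \<mu> by (auto intro!: sum.remove)
  then have n: "n = (\<Sum>\<nu><L. e' \<nu>)" using Suc.prems(2) \<mu> by (simp add: e'_def)
  define q where "q = (\<Prod>\<nu><L. [:a \<nu>, - b \<nu>:] ^ e' \<nu>)"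
  have "(\<Prod>\<nu><L. [:a \<nu>, - b \<nu>:] ^ e \<nu>) = [:a \<mu>, - b \<mu>:] ^ e \<mu> * (\<Prod>\<nu>\<in>{..<L}-{\<mu>}. [:a \<nu>, - b \<nu>:] ^ e \<nu>)"
    "q = [:a \<mu>, - b \<mu>:] ^ e' \<mu> * (\<Prod>\<nu>\<in>{..<L}-{\<mu>}. [:a \<nu>, - b \<nu>:] ^ e' \<nu>)"
    unfolding q_def using \<mu> by (auto intro!: prod.remove)
  moreover have "(\<Prod>\<nu>\<in>{..<L}-{\<mu>}. [:a \<nu>, - b \<nu>:] ^ e \<nu>) = (\<Prod>\<nu>\<in>{..<L}-{\<mu>}. [:a \<nu>, - b \<nu>:] ^ e' \<nu>)"
    by (intro prod.cong) (auto simp: e'_def)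
  moreover have "[:a \<mu>, - b \<mu>:] ^ e \<mu> = [:a \<mu>, - b \<mu>:] * [:a \<mu>, - b \<mu>:] ^ e' \<mu>"
    using \<mu> by (simp add: e'_def power_eq_if)
  ultimately have fac: "(\<Prod>\<nu><L. [:a \<nu>, - b \<nu>:] ^ e \<nu>) = [:a \<mu>, - b \<mu>:] * q"
    by (simp only: mult.assoc)
  have deg: "degree q \<le> n"
    unfolding q_def n by (rule degree_linear_product)
  let ?D = "Dlin (a \<mu>) (b \<mu>)"
  have "directional_op n q (?D f) p = 0" if "p \<in> U" for p
    using directional_op_linear_factor[OF U(1) Suc.prems(1) that deg, of "a \<mu>" "b \<mu>"] Suc.prems(3)[OF that]
    unfolding fac by simp
  then have "superposition U L a b \<alpha> \<beta> e' (?D f)"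
    using Suc.IH[OF holo2_Dlin[OF U(1) Suc.prems(1)] n] unfolding q_def by blast
  from superposition_antiderivative[OF U ab distinct transv \<mu>(1) this] obtain h where
    h: "holo2 U h" "superposition U L a b \<alpha> \<beta> e h" "\<And>p. p \<in> U \<Longrightarrow> ?D h p = ?D f p"
    unfolding e[symmetric] by blast
  let ?g = "\<lambda>p. f p + (- 1) * h p"
  have g: "holo2 U ?g" by (intro holo2_add holo2_cmult h Suc.prems)
  have "?D ?g p = 0" if "p \<in> U" for p
    using h(3)[OF that] by (simp only: Dlin_add[OF Suc.prems(1) holo2_cmult[OF h(1)] that] Dlin_cmult[OF h(1) that]) simp
  from function_of_lin[OF U g ab[OF \<mu>(1)] this] obtain F where
    F: "F holomorphic_on lin (a \<mu>) (b \<mu>) ` U" "\<And>p. p \<in> U \<Longrightarrow> ?g p = F (lin (a \<mu>) (b \<mu>) p)" by blast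
  have "superposition U L a b \<alpha> \<beta> e (\<lambda>p. h p + (case p of (x, y) \<Rightarrow> (\<alpha> \<mu> * x + \<beta> \<mu> * y) ^ 0 * F (lin (a \<mu>) (b \<mu>) (x, y))))"
    using \<mu> by (intro superposition_add h(2) superposition_term F(1)) auto
  then show ?case
    by (rule superposition_cong[rotated]) (auto simp: F(2)[symmetric])
qed

section \<open>The differential equation of the potential\<close>

text \<open>The relation number \<open>k\<close> is the coefficient of \<open>\<xi>\<^sup>m\<^sup>-\<^sup>1\<^sup>-\<^sup>k \<tau>\<^sup>k\<close> in \<open>2 (\<xi> \<partial>\<^sub>x + \<tau> \<partial>\<^sub>y) s = (q\<^sub>\<xi> \<partial>\<^sub>x + q\<^sub>\<tau> \<partial>\<^sub>y) f\<close>.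
  Substituting \<open>\<xi> \<mapsto> \<partial>\<^sub>y\<close> and \<open>\<tau> \<mapsto> - \<partial>\<^sub>x\<close> means to apply \<open>(- 1)\<^sup>k \<partial>\<^sub>x\<^sup>k \<partial>\<^sub>y\<^sup>m\<^sup>-\<^sup>1\<^sup>-\<^sup>k\<close> to it and to add up; the left hand
  sides then telescope, and the right hand sides collect into the rotation polynomial.\<close>

lemma directional_op_rotation_poly_eq_0:
  assumes U: "open U" and f: "holo2 U f" and \<sigma>: "\<And>k. holo2 U (\<sigma> k)"
    and \<sigma>0: "\<And>p. \<sigma> 0 p = 0" and \<sigma>m: "\<And>p. \<sigma> m p = 0"
    and rel: "\<And>k q. k < m \<Longrightarrow> q \<in> U \<Longrightarrow> 2 * dx (\<sigma> (Suc k)) q + 2 * dy (\<sigma> k) q =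
      of_nat (m - k) * c k * dx f q + of_nat (Suc k) * c (Suc k) * dy f q"
    and p: "p \<in> U"
  shows "directional_op m (rotation_poly m c) f p = 0"
proof -
  have \<sigma>0': "\<sigma> 0 = (\<lambda>_. 0)" and \<sigma>m': "\<sigma> m = (\<lambda>_. 0)" using \<sigma>0 \<sigma>m by auto
  define t where "t = (\<lambda>k. (- 1) ^ k * dxy k (m - k) (\<sigma> k) p)"
  let ?d = "\<lambda>k. dxy k (m - k) f p"
  have lin: "dxy i j (\<lambda>q. a * dx g q + b * dy h q) p = a * dxy (Suc i) j g p + b * dxy i (Suc j) h p"
    if "holo2 U g" "holo2 U h" for a b g h i j
    using that
    by (simp add: dxy_add[OF U holo2_cmult[OF holo2_dx[OF U]] holo2_cmult[OF holo2_dy[OF U]] p]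
        dxy_cmult[OF U holo2_dx[OF U] p] dxy_cmult[OF U holo2_dy[OF U] p] dxy_dx[OF U _ p] dxy_dy)
  have step: "2 * (t k - t (Suc k)) = (- 1) ^ k * (of_nat (m - k) * c k * ?d (Suc k) + of_nat (Suc k) * c (Suc k) * ?d k)"
    if k: "k < m" for k
  proof -
    have e: "m - k = Suc (m - Suc k)" using k by simp
    have "dxy k (m - Suc k) (\<lambda>q. 2 * dx (\<sigma> (Suc k)) q + 2 * dy (\<sigma> k) q) p =
      dxy k (m - Suc k) (\<lambda>q. of_nat (m - k) * c k * dx f q + of_nat (Suc k) * c (Suc k) * dy f q) p"
      by (rule dxy_cong[OF U rel[OF k] p])
    then have "2 * dxy (Suc k) (m - Suc k) (\<sigma> (Suc k)) p + 2 * dxy k (m - k) (\<sigma> k) p =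
      of_nat (m - k) * c k * ?d (Suc k) + of_nat (Suc k) * c (Suc k) * ?d k"
      unfolding lin[OF \<sigma> \<sigma>] lin[OF f f] e[symmetric] .
    from arg_cong[OF this, of "\<lambda>x. (- 1) ^ k * x"] show ?thesis by (simp add: t_def algebra_simps)
  qed
  have "(\<Sum>k<m. 2 * (t k - t (Suc k))) = 2 * (t 0 - t m)"
    by (simp only: sum_distrib_left[symmetric] sum_lessThan_telescope')
  then have 0: "(\<Sum>k<m. 2 * (t k - t (Suc k))) = 0" by (simp add: t_def \<sigma>0' \<sigma>m')
  have "directional_op m (rotation_poly m c) f p =
     (\<Sum>k\<le>m. (if k < m then of_nat (Suc k) * c (Suc k) else 0) * (- 1) ^ k * ?d k) -
     (\<Sum>k\<le>m. (case k of 0 \<Rightarrow> 0 | Suc j \<Rightarrow> of_nat (m - j) * c j) * (- 1) ^ k * ?d k)"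
    unfolding directional_op_def sum_subtractf[symmetric]
    by (intro sum.cong refl) (auto simp: coeff_rotation_poly left_diff_distrib)
  also have "(\<Sum>k\<le>m. (if k < m then of_nat (Suc k) * c (Suc k) else 0) * (- 1) ^ k * ?d k) =
     (\<Sum>k<m. of_nat (Suc k) * c (Suc k) * (- 1) ^ k * ?d k)"
    by (simp add: lessThan_Suc_atMost[symmetric] del: of_nat_Suc)
  also have "(\<Sum>k\<le>m. (case k of 0 \<Rightarrow> 0 | Suc j \<Rightarrow> of_nat (m - j) * c j) * (- 1) ^ k * ?d k) =
     (\<Sum>k<m. of_nat (m - k) * c k * (- 1) ^ Suc k * ?d (Suc k))"
    unfolding lessThan_Suc_atMost[symmetric] by (subst sum.lessThan_Suc_shift) simp
  also have "(\<Sum>k<m. of_nat (Suc k) * c (Suc k) * (- 1) ^ k * ?d k) - (\<Sum>k<m. of_nat (m - k) * c k * (- 1) ^ Suc k * ?d (Suc k)) =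
     (\<Sum>k<m. 2 * (t k - t (Suc k)))"
    unfolding sum_subtractf[symmetric]
  proof (intro sum.cong refl)
    fix k assume "k \<in> {..<m}"
    then show "of_nat (Suc k) * c (Suc k) * (- 1) ^ k * ?d k - of_nat (m - k) * c k * (- 1) ^ Suc k * ?d (Suc k) = 2 * (t k - t (Suc k))"
      by (subst step) (simp_all add: distrib_left mult_ac del: of_nat_Suc of_nat_diff)
  qed
  finally show ?thesis using 0 by simp
qed

lemma directional_op_rotation_poly_potential:
  fixes R :: "complex \<times> complex \<Rightarrow> complex ^ 'l ^ 'l::finite"
  assumes U: "open U" and R: "holo2_mat U R"
    and S: "\<And>i j. i + j + 2 \<le> m \<Longrightarrow> holo2_mat U (S i j)"
    and comm: "commute_on U (op_P R) (op_Q m c S)" and p: "p \<in> U"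
  shows "directional_op m (rotation_poly m c) (\<lambda>p. R p $ r $ s) p = 0"
proof -
  \<comment> \<open>The leading coefficients of \<open>S\<close>, with the index shifted by one and a zero added at each end so that
    the relations have the same form for all \<open>k\<close>.\<close>
  define \<sigma> where "\<sigma> = (\<lambda>k p. if 0 < k \<and> k < m then S (m - 1 - k) (k - 1) p $ r $ s else 0)"
  have \<sigma>: "\<sigma> k = (if 0 < k \<and> k < m then (\<lambda>p. S (m - 1 - k) (k - 1) p $ r $ s) else (\<lambda>_. 0))" for k
    by (auto simp: \<sigma>_def)
  have d0: "dx (\<lambda>_. 0) q = 0" "dy (\<lambda>_. 0) q = 0" for q
    by (cases q, simp add: dx_apply dy_apply)+
  show ?thesis
  proof (rule directional_op_rotation_poly_eq_0[OF U])
    show "holo2 U (\<lambda>p. R p $ r $ s)" using R by (simp add: holo2_mat_def)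
    show "holo2 U (\<sigma> k)" for k
    proof (cases "0 < k \<and> k < m")
      case True
      then have "holo2_mat U (S (m - 1 - k) (k - 1))" by (intro S) auto
      then show ?thesis using True by (simp add: \<sigma> holo2_mat_def)
    next
      case False
      then show ?thesis unfolding \<sigma> if_not_P[OF False] by simp
    qed
    show "\<sigma> 0 p = 0" "\<sigma> m p = 0" for p by (simp_all add: \<sigma>_def)
    show "2 * dx (\<sigma> (Suc k)) q + 2 * dy (\<sigma> k) q =
      of_nat (m - k) * c k * dx (\<lambda>p. R p $ r $ s) q + of_nat (Suc k) * c (Suc k) * dy (\<lambda>p. R p $ r $ s) q"
      if k: "k < m" and q: "q \<in> U" for k q
    proof -
      have "2 * dx (\<sigma> (Suc k)) q = (if 0 < m - 1 - k then 2 * dx (\<lambda>p. S (m - 1 - k - 1) k p $ r $ s) q else 0)"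
        using k by (auto simp: \<sigma> d0)
      moreover have "2 * dy (\<sigma> k) q = (if 0 < k then 2 * dy (\<lambda>p. S (m - 1 - k) (k - 1) p $ r $ s) q else 0)"
        using k by (auto simp: \<sigma> d0)
      moreover have "Suc (m - 1 - k) = m - k" using k by simp
      ultimately show ?thesis
        using leading_commutator_relation[OF U R S comm _ q, of "m - 1 - k" k r s] k by simp
    qed
  qed (rule p)
qed

text \<open>The derivative of the transverse form in the direction \<open>(b, a)\<close> is \<open>a\<^sup>2 + b\<^sup>2\<close> if this is nonzero, and
  \<open>2 a b\<close> otherwise.\<close>

lemma transverse_form_derivative_neq_0:
  assumes "(a, b) \<noteq> (0, 0)"
  shows "b * (if a\<^sup>2 + b\<^sup>2 = 0 then a else b) + a * (if a\<^sup>2 + b\<^sup>2 = 0 then b else a) \<noteq> (0::complex)"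
proof (cases "a\<^sup>2 + b\<^sup>2 = 0")
  case True
  then have "a \<noteq> 0" "b \<noteq> 0" using assms by auto
  then show ?thesis using True by simp
qed (simp add: power2_eq_square add.commute)

theorem theorem8p1:
  fixes U :: "(complex \<times> complex) set"
    and m :: nat
    and c :: "nat \<Rightarrow> complex"
    and R :: "complex \<times> complex \<Rightarrow> complex ^ 'l ^ 'l::finite"
    and S :: "nat \<Rightarrow> nat \<Rightarrow> complex \<times> complex \<Rightarrow> complex ^ 'l ^ 'l"
  assumes "open U" and "convex U"
    and "0 < m"
    and "holo2_mat U R"
    and "\<And>i j. i + j + 2 \<le> m \<Longrightarrow> holo2_mat U (S i j)"
    and "commute_on U (op_P R) (op_Q m c S)"
    and "symbol_Q m c \<notin> polys_in symbol_P"
  shows "(\<exists>L a b e. symbol_factorization m c L a b e) \<and>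
    (\<forall>L a b e. symbol_factorization m c L a b e \<longrightarrow>
      (\<exists>F :: nat \<Rightarrow> nat \<Rightarrow> complex \<Rightarrow> complex ^ 'l ^ 'l.
        (\<forall>\<nu><L. \<forall>i<e \<nu>. \<forall>r s.
          (\<lambda>t. F \<nu> i t $ r $ s) holomorphic_on ((\<lambda>(x, y). a \<nu> * x - b \<nu> * y) ` U)) \<and>
        (\<forall>x y. (x, y) \<in> U \<longrightarrow>
          R (x, y) = (\<Sum>\<nu><L. \<Sum>i<e \<nu>.
            mat_scale (transverse_form (a \<nu>) (b \<nu>) x y ^ i) (F \<nu> i (a \<nu> * x - b \<nu> * y))))))"
proof (intro conjI allI impI)
  show "\<exists>L a b e. symbol_factorization m c L a b e"
    by (rule symbol_factorization_exists) fact+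
  fix L a b e assume fac: "symbol_factorization m c L a b e"
  define \<alpha> where "\<alpha> = (\<lambda>\<nu>. if (a \<nu>)\<^sup>2 + (b \<nu>)\<^sup>2 = 0 then a \<nu> else b \<nu>)"
  define \<beta> where "\<beta> = (\<lambda>\<nu>. if (a \<nu>)\<^sup>2 + (b \<nu>)\<^sup>2 = 0 then b \<nu> else a \<nu>)"
  have transv: "b \<nu> * \<alpha> \<nu> + a \<nu> * \<beta> \<nu> \<noteq> 0" if "(a \<nu>, b \<nu>) \<noteq> (0, 0)" for \<nu>
    using transverse_form_derivative_neq_0[OF that] by (simp add: \<alpha>_def \<beta>_def)
  have T: "transverse_form (a \<nu>) (b \<nu>) x y = \<alpha> \<nu> * x + \<beta> \<nu> * y" for \<nu> x y
    by (simp add: transverse_form_def \<alpha>_def \<beta>_def)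
  have superposition: "superposition U L a b \<alpha> \<beta> e (\<lambda>p. R p $ r $ s)" for r s
  proof (rule superposition_kernel[OF assms(1,2)])
    show ab: "(a \<nu>, b \<nu>) \<noteq> (0, 0)" if "\<nu> < L" for \<nu>
      using fac that by (simp add: symbol_factorization_def)
    show "a \<nu> * b \<mu> \<noteq> a \<mu> * b \<nu>" if "\<nu> < L" "\<mu> < L" "\<mu> \<noteq> \<nu>" for \<nu> \<mu>
      using fac that by (simp add: symbol_factorization_def)
    show "b \<nu> * \<alpha> \<nu> + a \<nu> * \<beta> \<nu> \<noteq> 0" if "\<nu> < L" for \<nu> using transv ab that by blast
    show "holo2 U (\<lambda>p. R p $ r $ s)" using assms(4) by (simp add: holo2_mat_def)
    show "m = (\<Sum>\<nu><L. e \<nu>)" using fac by (simp add: symbol_factorization_def)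
    show "directional_op m (\<Prod>\<nu><L. [:a \<nu>, - b \<nu>:] ^ e \<nu>) (\<lambda>p. R p $ r $ s) p = 0" if "p \<in> U" for p
      unfolding symbol_factorization_rotation_poly[OF fac, symmetric]
      by (rule directional_op_rotation_poly_potential[OF assms(1,4,5,6) that])
  qed
  have "\<forall>r s. \<exists>F. (\<forall>\<nu><L. \<forall>i<e \<nu>. F \<nu> i holomorphic_on lin (a \<nu>) (b \<nu>) ` U) \<and>
     (\<forall>(x, y)\<in>U. R (x, y) $ r $ s = (\<Sum>\<nu><L. \<Sum>i<e \<nu>. (\<alpha> \<nu> * x + \<beta> \<nu> * y) ^ i * F \<nu> i (lin (a \<nu>) (b \<nu>) (x, y))))"
    using superposition unfolding superposition_def by blast
  then obtain G where G: "\<forall>r s. (\<forall>\<nu><L. \<forall>i<e \<nu>. G r s \<nu> i holomorphic_on lin (a \<nu>) (b \<nu>) ` U) \<and>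
     (\<forall>(x, y)\<in>U. R (x, y) $ r $ s = (\<Sum>\<nu><L. \<Sum>i<e \<nu>. (\<alpha> \<nu> * x + \<beta> \<nu> * y) ^ i * G r s \<nu> i (lin (a \<nu>) (b \<nu>) (x, y))))"
    unfolding choice_iff by blast
  define F :: "nat \<Rightarrow> nat \<Rightarrow> complex \<Rightarrow> complex ^ 'l ^ 'l" where "F = (\<lambda>\<nu> i t. \<chi> r s. G r s \<nu> i t)"
  show "\<exists>F :: nat \<Rightarrow> nat \<Rightarrow> complex \<Rightarrow> complex ^ 'l ^ 'l.
        (\<forall>\<nu><L. \<forall>i<e \<nu>. \<forall>r s.
          (\<lambda>t. F \<nu> i t $ r $ s) holomorphic_on ((\<lambda>(x, y). a \<nu> * x - b \<nu> * y) ` U)) \<and>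
        (\<forall>x y. (x, y) \<in> U \<longrightarrow>
          R (x, y) = (\<Sum>\<nu><L. \<Sum>i<e \<nu>.
            mat_scale (transverse_form (a \<nu>) (b \<nu>) x y ^ i) (F \<nu> i (a \<nu> * x - b \<nu> * y))))"
  proof (intro exI[of _ F] conjI allI impI)
    show "(\<lambda>t. F \<nu> i t $ r $ s) holomorphic_on ((\<lambda>(x, y). a \<nu> * x - b \<nu> * y) ` U)"
      if "\<nu> < L" "i < e \<nu>" for \<nu> i r s
      using G that by (simp add: F_def lin_def)
    fix x y assume "(x, y) \<in> U"
    then have "R (x, y) $ r $ s = (\<Sum>\<nu><L. \<Sum>i<e \<nu>. (\<alpha> \<nu> * x + \<beta> \<nu> * y) ^ i * G r s \<nu> i (lin (a \<nu>) (b \<nu>) (x, y)))" for r s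
      using G by blast
    then show "R (x, y) = (\<Sum>\<nu><L. \<Sum>i<e \<nu>.
            mat_scale (transverse_form (a \<nu>) (b \<nu>) x y ^ i) (F \<nu> i (a \<nu> * x - b \<nu> * y)))"
      by (simp add: vec_eq_iff mat_scale_def F_def T lin_def)
  qed
qed

end
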